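(* In the QC setting, for every initial state $\mathbf{x}(0)\in\mathbb{R}^N$ and every $a>0$, $$\mathbb{P}\Big[\sup_{j\ge0}\|\mathbf{x}(j)\|>a\Big]\le\frac{\Big[2Nx_{\rm avg}^2(0)+\frac{4|\mathcal{M}|\Delta^2}{3N}\sum_{j\ge0}\alpha^2(j)\Big]^{1/2}}{a}+\frac{\big(1+\mathbf{x}(0)^T\overline{L}\mathbf{x}(0)\big)\prod_{j\ge0}(1+g(j))}{1+\frac{a^2}{2}\lambda_2(\overline{L})},$$ where $x_{\rm avg}(0)=\frac1N\mathbf{1}^T\mathbf{x}(0)$ and $g(j)=\alpha^2(j)\max\Big(\frac{\lambda_N^3(\overline{L})}{\lambda_2(\overline{L})}+\frac{4N^2\lambda_N(\overline{L})}{\lambda_2(\overline{L})},\ \frac{2|\mathcal{M}|\Delta^2\lambda_N(\overline{L})}{3}\Big)$.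
   Context: QC setting. Let $N\ge 2$; all random objects live on one probability space. $\{L(i)\}_{i\ge0}$ is an i.i.d. sequence of random graph Laplacians $L(i)=D(i)-A(i)$, where $A(i)$ is the adjacency matrix (symmetric, $\{0,1\}$-valued, zero diagonal) of a random undirected simple graph on $\{1,\dots,N\}$, $D(i)=\mathrm{diag}(d_1(i),\dots,d_N(i))$ with $d_n(i)$ the degree of node $n$, and $\Omega_n(i)=\{l:A_{nl}(i)=1\}$. Link failures at a given time may be arbitrarily correlated across edges. Let $\overline{L}=\mathbb{E}[L(i)]$ with eigenvalues $0=\lambda_1(\overline{L})\le\lambda_2(\overline{L})\le\cdots\le\lambda_N(\overline{L})$; assume $\lambda_2(\overline{L})>0$. $\mathcal{M}$ denotes the set of realizable edges (those appearing in the random graph with positive probability). Quantizer: step $\Delta>0$, $q(y)=k\Delta$ if $(k-\tfrac12)\Delta\le y<(k+\tfrac12)\Delta$, $k\in\mathbb{Z}$. Dither: $\{\nu_{nl}(i)\}$ i.i.d. uniform on $[-\Delta/2,\Delta/2)$, independent of $\{L(i)\}$. Weights: deterministic $\alpha(i)>0$ with $\sum_i\alpha(i)=\infty$, $\sum_i\alpha^2(i)<\infty$. QC recursion: $x_n(i+1)=(1-\alpha(i)d_n(i))x_n(i)+\alpha(i)\sum_{l\in\Omega_n(i)}q(x_l(i)+\nu_{nl}(i))$, with deterministic $\mathbf{x}(0)$. With $\varepsilon_{nl}(i)=q(x_l(i)+\nu_{nl}(i))-(x_l(i)+\nu_{nl}(i))$, $\Upsilon_n(i)=-\sum_{l\in\Omega_n(i)}\nu_{nl}(i)$,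 $\Psi_n(i)=-\sum_{l\in\Omega_n(i)}\varepsilon_{nl}(i)$, this reads $\mathbf{x}(i+1)=\mathbf{x}(i)-\alpha(i)[L(i)\mathbf{x}(i)+\Upsilon(i)+\Psi(i)]$. Conditionally on $\mathbf{x}(0),\{L(j),\Upsilon(j),\Psi(j)\}_{j<i}$ and $L(i)$, the $\varepsilon_{nl}(i)$ are i.i.d. uniform on $[-\Delta/2,\Delta/2)$ (as are the $\nu_{nl}(i)$). *)

theory Defs
  imports "HOL-Probability.Probability"
begin

definition quant :: "real \<Rightarrow> real \<Rightarrow> real" where
  "quant Delta y = Delta * of_int (THE k::int. (of_int k - 1/2) * Delta \<le> y \<and> y < (of_int k + 1/2) * Delta)"

definition laplacian :: "('n::finite \<Rightarrow> 'n \<Rightarrow> bool) \<Rightarrow> real^'n^'n" where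
  "laplacian Adj = (\<chi> n l. (if n = l then real (card {k. Adj n k}) else 0) - (if Adj n l then 1 else 0))"

definition charpoly :: "real^'n^'n \<Rightarrow> real poly" where
  "charpoly A = det ((\<chi> i j. if i = j then [:0, 1:] else 0) - (\<chi> i j. [: A $ i $ j :]))"

text \<open>Eigenvalues counted with multiplicity, in nondecreasing order
  (for a real symmetric matrix the characteristic polynomial splits over the reals).\<close>
definition eigs :: "real^'n^'n \<Rightarrow> real list" where
  "eigs A = (THE ls. sorted ls \<and> charpoly A = (\<Prod>a\<leftarrow>ls. [:- a, 1:]))"

definition eigval :: "real^'n^'n \<Rightarrow> nat \<Rightarrow> real" where
  "eigval A k = eigs A ! (k - 1)"

text \<open>The QC recursion, pathwise: Adj i w is the random graph at time i, nu i n l w the dither.\<close>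
primrec qc_state :: "real \<Rightarrow> (nat \<Rightarrow> real) \<Rightarrow> (nat \<Rightarrow> 'a \<Rightarrow> 'n::finite \<Rightarrow> 'n \<Rightarrow> bool)
    \<Rightarrow> (nat \<Rightarrow> 'n \<Rightarrow> 'n \<Rightarrow> 'a \<Rightarrow> real) \<Rightarrow> real^'n \<Rightarrow> nat \<Rightarrow> 'a \<Rightarrow> real^'n" where
  "qc_state Delta alpha Adj nu x0 0 w = x0"
| "qc_state Delta alpha Adj nu x0 (Suc i) w =
     (\<chi> n. (1 - alpha i * real (card {l. Adj i w n l})) * (qc_state Delta alpha Adj nu x0 i w $ n)
        + alpha i * (\<Sum>l\<in>{l. Adj i w n l}. quant Delta (qc_state Delta alpha Adj nu x0 i w $ l + nu i n l w)))"

end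

(* Split ||x||^2 into N times the squared average and the squared distance to consensus.
   Given the past and the current graph, the total error q(x + nu) - x of a dithered quantizer
   has mean zero and variance at most Delta^2 / 4, since it takes only two values.
   Hence the squared average plus the remaining noise budget is a supermartingale.  So is
   (1 + x^T Lbar x) divided by the partial products of 1 + g: the drift -2 alpha |Lbar x|^2 is
   dropped, and the quadratic terms are absorbed by g because x^T Lbar x dominates
   lambda_2 times the squared distance to consensus.  The maximal inequality is applied to both;
   a probability p with p <= r also satisfies p <= sqrt r, as p <= 1. *)

theory Submission
  imports Defs
begin

subsection \<open>Spectral bounds for symmetric matrices\<close>

text \<open>Both supermartingales come from one computation: for a symmetric positive semidefinite
  \<open>B\<close>, follow \<open>p j * (x \<bullet> (B *v x)) + r j\<close> with deterministic
  weights. If every entry of \<open>B\<close> is 1/N^2, the form is the squared average, and all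
  Laplacian terms vanish because a Laplacian maps into the vectors orthogonal to 1. The other choice
  is \<open>B = Lbar\<close>; there the added 1 lets additive noise be absorbed by a multiplicative
  factor. The obstacle is the bookkeeping of independence: the edges of one graph may be correlated,
  the state depends on all earlier graphs and dithers, and the noise is multiplied by the current
  graph. So every graph and every dither is a separate source, sigma-algebras are generated by sets
  of sources, and conditional statements become integrals against indicators of past events.
  Integrability is cheap, since at each fixed time everything is essentially bounded. If |x| exceeds
  a, one of the two parts of |x|^2 is at least a^2/2; this equal split produces the factors 2N and
  a^2/2 of the bound.\<close>

lemma sym_mat_inner:
  fixes A :: "real^'n^'n"
  assumes "transpose A = A"
  shows "(A *v x) \<bullet> y = x \<bullet> (A *v y)"
  by (metis assms dot_lmul_matrix transpose_matrix_vector)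

text \<open>By compactness the quadratic form has a maximizer \<open>u\<close> on the unit sphere of
  \<open>S\<close>. Its residual \<open>z\<close> lies in \<open>S\<close> and is orthogonal to
  \<open>u\<close>; moving from \<open>u\<close> along \<open>- z\<close> would increase the form to
  first order unless \<open>z = 0\<close>.\<close>

lemma rayleigh_max_eigenvector:
  fixes A :: "real^'n^'n"
  assumes sym: "transpose A = A" and S: "subspace S"
    and inv: "\<And>x. x \<in> S \<Longrightarrow> A *v x \<in> S" and nz: "\<exists>x\<in>S. x \<noteq> 0"
  shows "\<exists>u\<in>S. norm u = 1 \<and> (\<exists>c. A *v u = c *\<^sub>R u)"
proof -
  define K where "K = S \<inter> sphere 0 1"
  have cK: "compact K"
    unfolding K_def using closed_subspace[OF S] by (simp add: closed_Int_compact)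
  obtain x where x: "x \<in> S" "x \<noteq> 0" using nz by blast
  have "(1 / norm x) *\<^sub>R x \<in> K"
    using x S by (simp add: K_def subspace_scale)
  then have neK: "K \<noteq> {}" by blast
  have "continuous_on K (\<lambda>x. x \<bullet> (A *v x))"
    by (intro continuous_intros linear_continuous_on linear_conv_bounded_linear[THEN iffD1]) auto
  from continuous_attains_sup[OF cK neK this] obtain u where u: "u \<in> K"
    and mx: "\<And>y. y \<in> K \<Longrightarrow> y \<bullet> (A *v y) \<le> u \<bullet> (A *v u)" by blast
  define m where "m = u \<bullet> (A *v u)"
  have uS: "u \<in> S" and nu: "norm u = 1" using u by (auto simp: K_def)
  have uu: "u \<bullet> u = 1" using nu by (simp add: dot_square_norm)
  have Q: "y \<bullet> (A *v y) \<le> m * (y \<bullet> y)" if "y \<in> S" for y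
  proof (cases "y = 0")
    case False
    have "(1 / norm y) *\<^sub>R y \<in> K" using that False S by (simp add: K_def subspace_scale)
    from mx[OF this] have "(y \<bullet> (A *v y)) / (norm y)\<^sup>2 \<le> m"
      by (simp add: m_def matrix_vector_mult_scaleR power2_eq_square)
    then show ?thesis using False by (simp add: dot_square_norm field_simps)
  qed simp
  define z where "z = m *\<^sub>R u - A *v u"
  have zS: "z \<in> S" unfolding z_def using uS inv S by (simp add: subspace_diff subspace_scale)
  have zu: "z \<bullet> u = 0" using uu by (simp add: z_def m_def inner_diff_left inner_diff_right inner_commute)
  have "z \<bullet> z = z \<bullet> (m *\<^sub>R u - A *v u)" by (simp only: z_def)
  then have zz: "z \<bullet> z = - (z \<bullet> (A *v u))" using zu by (simp add: inner_diff_right)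
  \<comment> \<open>The bound \<open>Q\<close> at the perturbed vector: the gain on the left is
    linear in \<open>t\<close>, the loss on the right quadratic.\<close>
  have key: "2 * t * (z \<bullet> z) \<le> t\<^sup>2 * (m * (z \<bullet> z) - z \<bullet> (A *v z))" for t :: real
  proof -
    have "u - t *\<^sub>R z \<in> S" using uS zS S by (simp add: subspace_diff subspace_scale)
    from Q[OF this] have "m - t * (u \<bullet> (A *v z)) - t * (z \<bullet> (A *v u)) + t\<^sup>2 * (z \<bullet> (A *v z))
        \<le> m * (1 + t\<^sup>2 * (z \<bullet> z))"
      using zu uu
      by (simp add: matrix_vector_mult_diff_distrib matrix_vector_mult_scaleR inner_diff_left
          inner_diff_right inner_commute m_def power2_eq_square algebra_simps)
    moreover have "u \<bullet> (A *v z) = z \<bullet> (A *v u)"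
      using sym_mat_inner[OF sym, of u z] by (simp add: inner_commute)
    ultimately show ?thesis using zz by (simp add: algebra_simps)
  qed
  \<comment> \<open>A positive majorant of the second-order coefficient, so that
    \<open>t = (z \<bullet> z) / C\<close> is small enough for the linear term to win.\<close>
  define C where "C = \<bar>m * (z \<bullet> z) - z \<bullet> (A *v z)\<bar> + 1"
  have C: "C > 0" "m * (z \<bullet> z) - z \<bullet> (A *v z) \<le> C" by (auto simp: C_def)
  have "z \<bullet> z = 0"
  proof (rule ccontr)
    assume "z \<bullet> z \<noteq> 0"
    then have p: "z \<bullet> z > 0" by simp
    have "2 * ((z \<bullet> z) / C) * (z \<bullet> z) \<le> ((z \<bullet> z) / C)\<^sup>2 * C"
      using key[of "(z \<bullet> z) / C"] C(2) by (meson mult_left_mono order_trans zero_le_power2)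
    then have "(z \<bullet> z) * (z \<bullet> z) \<le> 0" using C(1) by (simp add: power2_eq_square field_simps)
    then show False using mult_pos_pos[OF p p] by linarith
  qed
  then have "A *v u = m *\<^sub>R u" by (simp add: z_def)
  then show ?thesis using uS nu by blast
qed

text \<open>Take an orthonormal set of eigenvectors of maximal size. By symmetry its orthogonal
  complement is invariant under \<open>A\<close>; were it nonzero, it would contain one more unit
  eigenvector.\<close>

lemma symmetric_orthonormal_eigenbasis:
  fixes A :: "real^'n^'n"
  assumes sym: "transpose A = A"
  obtains u :: "'n \<Rightarrow> real^'n" and d :: "'n \<Rightarrow> real"
  where "\<And>i j. u i \<bullet> u j = (if i = j then 1 else 0)" "\<And>i. A *v u i = d i *\<^sub>R u i"
proof -
  define P where "P B \<longleftrightarrow> pairwise orthogonal B \<and> (\<forall>b\<in>B. norm b = 1 \<and> (\<exists>c. A *v b = c *\<^sub>R b))"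
    for B :: "(real^'n) set"
  have ind: "independent B" if "P B" for B
    using that unfolding P_def by (intro pairwise_orthogonal_independent) auto
  have fin: "finite B" and le: "card B \<le> CARD('n)" if "P B" for B
    using independent_bound[OF ind[OF that]] by auto
  have "\<exists>B. P B \<and> (\<forall>B'. P B' \<longrightarrow> card B' \<le> card B)"
    by (rule ex_has_greatest_nat[of P "{}" card "Suc CARD('n)"])
       (auto simp: less_Suc_eq_le le, simp add: P_def)
  then obtain B where B: "P B" and mx: "\<And>B'. P B' \<Longrightarrow> card B' \<le> card B" by blast
  have "card B = CARD('n)"
  proof (rule ccontr)
    assume "card B \<noteq> CARD('n)"
    then have "dim B < DIM(real^'n)" using le[OF B] ind[OF B] by (simp add: dim_eq_card_independent)
    from orthogonal_to_subspace_exists[OF this] obtain x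
      where x: "x \<noteq> 0" "\<And>y. y \<in> span B \<Longrightarrow> orthogonal x y" by blast
    define S where "S = {x. \<forall>b\<in>B. x \<bullet> b = 0}"
    have "\<exists>u\<in>S. norm u = 1 \<and> (\<exists>c. A *v u = c *\<^sub>R u)"
    proof (rule rayleigh_max_eigenvector[OF sym])
      show "subspace S" by (auto simp: S_def subspace_def inner_add_left)
      show "A *v x \<in> S" if "x \<in> S" for x
        using that B by (fastforce simp: S_def P_def sym_mat_inner[OF sym])
      show "\<exists>x\<in>S. x \<noteq> 0" 
      proof
        show "x \<in> S" using x(2) by (simp add: S_def orthogonal_def span_base)
      qed (rule x(1))
    qed
    then obtain u c where u: "u \<in> S" "norm u = 1" "A *v u = c *\<^sub>R u" by blast
    have "u \<notin> B" using u by (auto simp: S_def dest!: bspec[of _ _ u])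
    moreover have "P (insert u B)" using u B
      by (auto simp: P_def pairwise_insert S_def orthogonal_def inner_commute)
    ultimately show False using mx[of "insert u B"] fin[OF B] by auto
  qed
  then obtain u :: "'n \<Rightarrow> real^'n" where u: "bij_betw u UNIV B"
    using finite_same_card_bij[of "UNIV :: 'n set" B] fin[OF B] by auto
  have mem: "u i \<in> B" for i using u by (auto simp: bij_betw_def)
  have "\<exists>c. A *v u i = c *\<^sub>R u i" for i using B mem by (auto simp: P_def)
  then obtain d where d: "\<And>i. A *v u i = d i *\<^sub>R u i" by metis
  have "u i \<bullet> u j = (if i = j then 1 else 0)" for i j
  proof (cases "i = j")
    case True then show ?thesis using B mem by (auto simp: P_def dot_square_norm)
  next
    case False
    then have "u i \<noteq> u j" using u by (auto simp: bij_betw_def inj_on_def)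
    then show ?thesis using B mem False by (auto simp: P_def pairwise_def orthogonal_def)
  qed
  then show ?thesis using d that by blast
qed

lemma poly_det: "poly (det M) t = det (\<chi> i j. poly (M $ i $ j) (t::real))"
  by (simp add: det_def poly_sum poly_prod)

text \<open>The matrix \<open>R\<close> with rows \<open>u i\<close> is orthogonal and conjugates
  \<open>A\<close> to a diagonal matrix. This gives the characteristic polynomial, Parseval's
  identity and the diagonal form of the quadratic form.\<close>

lemma orthonormal_diagonalization:
  fixes A :: "real^'n^'n" and u :: "'n \<Rightarrow> real^'n"
  assumes u: "\<And>i j. u i \<bullet> u j = (if i = j then 1 else 0)" and d: "\<And>i. A *v u i = d i *\<^sub>R u i"
  shows "charpoly A = (\<Prod>i\<in>UNIV. [:- d i, 1:])"
    and "x \<bullet> y = (\<Sum>i\<in>UNIV. (u i \<bullet> x) * (u i \<bullet> y))"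
    and "x \<bullet> (A *v x) = (\<Sum>i\<in>UNIV. d i * (u i \<bullet> x)\<^sup>2)"
proof -
  define R where "R = (\<chi> i. u i)"
  have RR: "R ** transpose R = mat 1"
    by (vector R_def matrix_matrix_mult_def transpose_def mat_def)
       (simp add: u[unfolded inner_vec_def, simplified])
  then have RR': "transpose R ** R = mat 1" using matrix_left_right_inverse by blast
  have RA: "R ** A ** transpose R = (\<chi> i j. if i = j then d i else 0)"
  proof -
    have "(R ** A ** transpose R) $ i $ j = u i \<bullet> (A *v u j)" for i j
      by (simp add: matrix_mul_assoc[symmetric])
         (simp add: R_def matrix_matrix_mult_def matrix_vector_mult_def transpose_def inner_vec_def)
    then show ?thesis by (simp add: vec_eq_iff d u)
  qed
  have Rx: "R *v x = (\<chi> i. u i \<bullet> x)" for x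
    by (simp add: vec_eq_iff R_def matrix_vector_mult_def inner_vec_def)
  have iso: "(R *v x) \<bullet> (R *v y) = x \<bullet> y" for x y
    by (metis RR' dot_lmul_matrix matrix_vector_mul_assoc matrix_vector_mul_lid transpose_matrix_vector transpose_transpose)
  show xy: "x \<bullet> y = (\<Sum>i\<in>UNIV. (u i \<bullet> x) * (u i \<bullet> y))" for x y
    using iso[of x y] by (simp add: Rx inner_vec_def)
  have "R *v (A *v x) = (R ** A ** transpose R) *v (R *v x)" for x
    by (metis RR' matrix_mul_assoc matrix_mul_rid matrix_vector_mul_assoc)
  then have "u i \<bullet> (A *v x) = ((\<chi> i j. if i = j then d i else 0) *v (\<chi> i. u i \<bullet> x)) $ i" for i x
    unfolding RA by (metis Rx vec_lambda_beta)
  moreover have "((\<chi> i j. if i = j then d i else 0) *v y) $ i = d i * y $ i" for i y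
  proof -
    have "(\<Sum>j\<in>UNIV. (if i = j then d i else 0) * y $ j) = (\<Sum>j\<in>UNIV. if i = j then d i * y $ j else 0)"
      by (rule sum.cong) auto
    then show ?thesis by (simp add: matrix_vector_mult_def)
  qed
  ultimately have "u i \<bullet> (A *v x) = d i * (u i \<bullet> x)" for i x by simp
  then show "x \<bullet> (A *v x) = (\<Sum>i\<in>UNIV. d i * (u i \<bullet> x)\<^sup>2)"
    by (simp add: xy[of x "A *v x"] power2_eq_square algebra_simps)
  \<comment> \<open>Real polynomials that agree at every point are equal, so it suffices to compute
    determinants of real matrices, where conjugation by \<open>R\<close> is available.\<close>
  have "poly (charpoly A) t = poly (\<Prod>i\<in>UNIV. [:- d i, 1:]) t" for t
  proof -
    define E where "E = (\<chi> i j. if i = j then t - d i else 0)"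
    have "det R * det (transpose R) = 1"
      by (metis RR det_I det_mul)
    have "R ** (mat t - A) ** transpose R = E"
    proof -
      have "R ** mat t = t *\<^sub>R R"
      proof -
        have "(\<Sum>k\<in>UNIV. R $ i $ k * (if k = j then t else 0)) = (\<Sum>k\<in>UNIV. if k = j then R $ i $ k * t else 0)" for i j
          by (rule sum.cong) auto
        then show ?thesis by (simp add: vec_eq_iff matrix_matrix_mult_def mat_def)
      qed
      then have "R ** mat t ** transpose R = t *\<^sub>R (R ** transpose R)"
        by (simp add: vec_eq_iff matrix_matrix_mult_def sum_distrib_left mult.assoc)
      then have "R ** mat t ** transpose R = mat t"
        by (simp add: RR vec_eq_iff mat_def)
      then have "R ** (mat t - A) ** transpose R = mat t - (\<chi> i j. if i = j then d i else 0)"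
      proof -
        have "X ** (Y - Z) = X ** Y - X ** Z" "(Y - Z) ** X = Y ** X - Z ** X" for X Y Z :: "real^'n^'n"
          by (simp_all add: vec_eq_iff matrix_matrix_mult_def algebra_simps sum_subtractf)
        then show "R ** mat t ** transpose R = mat t \<Longrightarrow> ?thesis" by (simp add: RA)
      qed
      then show ?thesis by (simp add: E_def vec_eq_iff mat_def)
    qed
    then have "det E = det R * det (mat t - A) * det (transpose R)"
      by (simp only: det_mul[symmetric])
    also have "\<dots> = det (mat t - A) * (det R * det (transpose R))"
      by (simp only: mult_ac)
    finally have "det (mat t - A) = det E"
      by (simp only: \<open>det R * det (transpose R) = 1\<close> mult_1_right)
    also have "\<dots> = (\<Prod>i\<in>UNIV. t - d i)"
      by (simp add: E_def det_diagonal)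
    finally have "det (mat t - A) = (\<Prod>i\<in>UNIV. t - d i)" .
    moreover have "poly (charpoly A) t = det (mat t - A)"
      unfolding charpoly_def poly_det by (rule arg_cong[of _ _ det]) (simp add: vec_eq_iff mat_def)
    ultimately show ?thesis by (simp add: poly_prod)
  qed
  then show "charpoly A = (\<Prod>i\<in>UNIV. [:- d i, 1:])"
    by (intro poly_eq_poly_eq_iff[THEN iffD1] ext) 
qed

text \<open>A product of monic linear factors determines the multiset of its roots, and a multiset
  has one sorted listing; hence the definite description in \<open>eigs\<close> denotes.\<close>

lemma eigs_eq_sorted:
  fixes d :: "'n::finite \<Rightarrow> real" and A :: "real^'n^'n"
  assumes "charpoly A = (\<Prod>i\<in>UNIV. [:- d i, 1:])"
  shows "sorted (eigs A)" "mset (eigs A) = image_mset d (mset_set UNIV)"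
proof -
  have roots: "proots (\<Prod>a\<leftarrow>ls. [:- a, 1:]) = mset ls" for ls :: "real list"
  proof (induction ls)
    case (Cons a ls)
    have "(\<Prod>a\<leftarrow>ls. [:- a, 1:]) \<noteq> 0" by (auto simp: prod_list_zero_iff)
    then show ?case using Cons by (simp add: proots_mult del: mult_pCons_left)
  qed simp
  define ls0 where "ls0 = sorted_list_of_multiset (image_mset d (mset_set UNIV))"
  have ls0: "sorted ls0" "mset ls0 = image_mset d (mset_set UNIV)" by (auto simp: ls0_def)
  have "(\<Prod>a\<leftarrow>ls0. [:- a, 1:]) = prod_mset (image_mset (\<lambda>a. [:- a, 1:]) (mset ls0))"
    by (simp only: prod_mset_prod_list mset_map[symmetric])
  also have "\<dots> = charpoly A"
    unfolding ls0 assms by (simp add: prod_unfold_prod_mset multiset.map_comp o_def)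
  finally have cp: "charpoly A = (\<Prod>a\<leftarrow>ls0. [:- a, 1:])" by simp
  have "eigs A = ls0"
    unfolding eigs_def
  proof (rule the_equality)
    show "sorted ls0 \<and> charpoly A = (\<Prod>a\<leftarrow>ls0. [:- a, 1:])" using ls0(1) cp by blast
    fix ls assume ls: "sorted ls \<and> charpoly A = (\<Prod>a\<leftarrow>ls. [:- a, 1:])"
    then have "mset ls = mset ls0" using roots[of ls] roots[of ls0] cp by argo
    then have "sort ls0 = ls" "sort ls0 = ls0" using ls ls0 by (auto intro: properties_for_sort)
    then show "ls = ls0" by simp
  qed
  then show "sorted (eigs A)" "mset (eigs A) = image_mset d (mset_set UNIV)" using ls0 by auto
qed

text \<open>As the second eigenvalue is positive and 1 is in the kernel, all basis eigenvectors
  except one belonging to the least eigenvalue are orthogonal to 1. A vector orthogonal to 1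
  therefore has no component along that exceptional one.\<close>

lemma symmetric_eigval_bounds:
  fixes A :: "real^'n^'n"
  assumes sym: "transpose A = A" and N2: "CARD('n) \<ge> 2"
    and ker: "A *v 1 = 0" and pos: "eigval A 2 > 0"
  shows "0 < eigval A CARD('n)"
    and "x \<bullet> (A *v x) \<le> eigval A CARD('n) * (x \<bullet> x)"
    and "x \<bullet> 1 = 0 \<Longrightarrow> eigval A 2 * (x \<bullet> x) \<le> x \<bullet> (A *v x)"
proof -
  obtain u :: "'n \<Rightarrow> real^'n" and d where u: "\<And>i j. u i \<bullet> u j = (if i = j then 1 else 0)"
    and d: "\<And>i. A *v u i = d i *\<^sub>R u i"
    using symmetric_orthonormal_eigenbasis[OF sym] by blast
  note diag = orthonormal_diagonalization[of u A d, OF u d]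
  note srt = eigs_eq_sorted[OF diag(1)]
  have len: "length (eigs A) = CARD('n)"
    using arg_cong[OF srt(2), of size] by simp
  have st: "set (eigs A) = range d"
    using arg_cong[OF srt(2), of set_mset] by simp
  have mono: "eigs A ! i \<le> eigs A ! j" if "i \<le> j" "j < CARD('n)" for i j
    using srt(1) that len by (simp add: sorted_nth_mono)
  have top: "d i \<le> eigval A CARD('n)" for i
  proof -
    have "d i \<in> set (eigs A)" using st by simp
    then obtain k where "k < CARD('n)" "d i = eigs A ! k" by (metis in_set_conv_nth len)
    then show ?thesis using mono[of k "CARD('n) - 1"] by (simp add: eigval_def)
  qed
  show "0 < eigval A CARD('n)"
  proof -
    have "eigs A ! 1 \<le> eigs A ! (CARD('n) - 1)" using N2 by (intro mono) linarith+
    then show ?thesis using pos by (simp add: eigval_def)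
  qed
  show "x \<bullet> (A *v x) \<le> eigval A CARD('n) * (x \<bullet> x)"
    unfolding diag(3) diag(2)[of x x] sum_distrib_left
    by (intro sum_mono) (use top in \<open>simp add: power2_eq_square[symmetric] mult_right_mono\<close>)
  \<comment> \<open>\<open>eigval\<close> counts from 1 and list positions from 0. Removing a single
    index \<open>i0\<close> for the head keeps multiplicities right: every other index has its
    eigenvalue in the tail, hence at least \<open>eigval A 2\<close>.\<close>
  obtain h t where ht: "eigs A = h # t" using len N2 by (cases "eigs A") auto
  then have "h \<in> range d" using st by auto
  then obtain i0 where i0: "h = d i0" by blast
  have "mset t = image_mset d (mset_set (UNIV - {i0}))"
  proof -
    have "mset_set (UNIV :: 'n set) = {#i0#} + mset_set (UNIV - {i0})"
      by (metis UNIV_I add_mset_add_single finite_UNIV mset_set.remove union_commute finite)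
    then show ?thesis using srt(2) ht i0 by simp
  qed
  then have stt: "set t = d ` (UNIV - {i0})"
    by (metis finite finite_set_mset_mset_set set_image_mset set_mset_mset)
  have low: "eigval A 2 \<le> d i" if "i \<noteq> i0" for i
  proof -
    have "d i \<in> set t" using stt that by auto
    then obtain k where "k < length t" "d i = t ! k" by (metis in_set_conv_nth)
    then show ?thesis using mono[of 1 "Suc k"] len by (simp add: eigval_def ht)
  qed
  have "u i \<bullet> 1 = 0" if "i \<noteq> i0" for i
  proof -
    have "d i * (u i \<bullet> 1) = (A *v u i) \<bullet> 1" by (simp add: d)
    also have "\<dots> = 0" by (simp add: sym_mat_inner[OF sym] ker)
    finally show ?thesis using low[OF that] pos by auto
  qed
  then have one: "x \<bullet> 1 = (u i0 \<bullet> x) * (u i0 \<bullet> 1)" for x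
    unfolding diag(2)[of x 1] by (subst sum.remove[of _ i0]) (auto intro!: sum.neutral)
  have "(1 :: real^'n) \<bullet> 1 \<noteq> 0" by simp
  then have n0: "u i0 \<bullet> 1 \<noteq> 0" using one[of 1] by auto
  show "eigval A 2 * (x \<bullet> x) \<le> x \<bullet> (A *v x)" if "x \<bullet> 1 = 0"
  proof -
    have "u i0 \<bullet> x = 0" using one[of x] n0 that by simp
    then show ?thesis
      unfolding diag(3) diag(2)[of x x] sum_distrib_left
      by (intro sum_mono) (metis low mult_right_mono mult_zero_right order_refl power2_eq_square zero_le_power2 zero_power2)
  qed
qed

subsection \<open>The dithered quantizer\<close>

text \<open>The half-open cells of width \<open>Delta\<close> partition the line, so the cell index
  is a floor; measurability follows from this form.\<close>

lemma quant_floor: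
  assumes "Delta > 0"
  shows "quant Delta y = Delta * of_int \<lfloor>y / Delta + 1/2\<rfloor>"
proof -
  have "(THE k::int. (of_int k - 1/2) * Delta \<le> y \<and> y < (of_int k + 1/2) * Delta) = \<lfloor>y / Delta + 1/2\<rfloor>"
  proof (rule the_equality)
    define z where "z = \<lfloor>y / Delta + 1/2\<rfloor>"
    have "of_int z \<le> y / Delta + 1/2" "y / Delta + 1/2 < of_int z + 1"
      unfolding z_def by linarith+
    then show "(of_int \<lfloor>y / Delta + 1/2\<rfloor> - 1/2) * Delta \<le> y \<and> y < (of_int \<lfloor>y / Delta + 1/2\<rfloor> + 1/2) * Delta"
      unfolding z_def[symmetric] using assms by (simp add: field_simps)
  next
    fix k :: int assume "(of_int k - 1/2) * Delta \<le> y \<and> y < (of_int k + 1/2) * Delta"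
    then have "of_int k \<le> y / Delta + 1/2" "y / Delta + 1/2 < of_int k + 1"
      using assms by (simp_all add: field_simps)
    then show "k = \<lfloor>y / Delta + 1/2\<rfloor>" by (simp add: floor_unique)
  qed
  then show ?thesis by (simp add: quant_def)
qed

lemma quant_measurable [measurable]:
  assumes "Delta > 0"
  shows "quant Delta \<in> borel_measurable borel"
  unfolding quant_floor[OF assms, abs_def] by measurable

text \<open>\<open>t\<close> is the remainder of \<open>x\<close> modulo \<open>Delta\<close>. As
  \<open>u\<close> runs over its interval, \<open>x + u\<close> sweeps a window of length
  \<open>Delta\<close> centred at \<open>x\<close>, which contains at most one rounding threshold,
  reached at \<open>u = Delta / 2 - t\<close>.\<close>

lemma quant_error_two_point:
  fixes Delta x u :: real
  assumes D: "Delta > 0"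
  defines "t \<equiv> x - Delta * of_int \<lfloor>x / Delta\<rfloor>"
  assumes u: "u \<in> {- Delta / 2 ..< Delta / 2}"
  shows "quant Delta (x + u) - x = - t + Delta * indicator {Delta / 2 - t ..< Delta / 2} u"
    and "0 \<le> t" "t < Delta"
proof -
  define k where "k = \<lfloor>x / Delta\<rfloor>"
  have k: "of_int k \<le> x / Delta" "x / Delta < of_int k + 1" by (auto simp: k_def)
  then show t: "0 \<le> t" "t < Delta" using D by (simp_all add: t_def k_def[symmetric] field_simps)
  have x: "x = t + Delta * of_int k" by (simp add: t_def k_def)
  have "\<lfloor>(x + u) / Delta + 1/2\<rfloor> = (if u < Delta / 2 - t then k else k + 1)"
    by (rule floor_unique) (use D u t in \<open>auto simp: x field_simps\<close>)
  then show "quant Delta (x + u) - x = - t + Delta * indicator {Delta / 2 - t ..< Delta / 2} u"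
    using u by (auto simp: quant_floor[OF D] x indicator_def algebra_simps)
qed

context
  fixes Delta :: real and U :: "real measure"
  assumes D: "Delta > 0" and U: "U = uniform_measure lborel {- Delta / 2 ..< Delta / 2}"
begin

lemma uniform_prob: "prob_space U"
  unfolding U using D by (intro prob_space_uniform_measure) auto

lemma uniform_AE: "AE u in U. u \<in> {- Delta / 2 ..< Delta / 2}"
  unfolding U by (intro AE_uniform_measureI) auto

lemma quant_error_integral:
  "(\<integral>u. quant Delta (x + u) - x \<partial>U) = 0"
  "(\<integral>u. (quant Delta (x + u) - x)\<^sup>2 \<partial>U) \<le> Delta\<^sup>2 / 4"
proof -
  interpret U: prob_space U by (rule uniform_prob)
  have sU: "sets U = sets borel" by (simp add: U)
  define t where "t = x - Delta * of_int \<lfloor>x / Delta\<rfloor>"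
  define I where "I = {Delta / 2 - t ..< Delta / 2}"
  have m[measurable]: "quant Delta \<in> borel_measurable borel" by (rule quant_measurable[OF D])
  have [measurable]: "I \<in> sets U" by (simp add: I_def sU)
  have [measurable_cong]: "sets U = sets borel" by (rule sU)
  have t: "0 \<le> t" "t < Delta"
    using quant_error_two_point(2,3)[OF D, of "- Delta / 2" x] D by (auto simp: t_def)
  have e: "AE u in U. quant Delta (x + u) - x = - t + Delta * indicator I u"
    using uniform_AE by eventually_elim (use quant_error_two_point(1)[OF D] in \<open>auto simp: t_def I_def\<close>)
  \<comment> \<open>The interval has length \<open>t\<close>, so the upward jump by
    \<open>Delta\<close> has probability \<open>t / Delta\<close>: the mean \<open>- t\<close> is
    cancelled exactly, and the second moment becomes \<open>t * (Delta - t)\<close>.\<close>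
  have PI: "measure U I = t / Delta"
    using D t unfolding U by (subst measure_uniform_measure) (auto simp: I_def Int_absorb1 measure_def)
  have int: "integrable U (indicator I :: real \<Rightarrow> real)"
    by (intro integrable_real_indicator) (auto simp: less_top[symmetric])
  have "(\<integral>u. quant Delta (x + u) - x \<partial>U) = (\<integral>u. - t + Delta * indicator I u \<partial>U)"
    by (rule integral_cong_AE) (use e in auto)
  also have "\<dots> = 0" using int D U.prob_space by (simp add: PI)
  finally show "(\<integral>u. quant Delta (x + u) - x \<partial>U) = 0" .
  have "(\<integral>u. (quant Delta (x + u) - x)\<^sup>2 \<partial>U) = (\<integral>u. t\<^sup>2 + (Delta\<^sup>2 - 2 * t * Delta) * indicator I u \<partial>U)"
  proof (rule integral_cong_AE)
    show "AE u in U. (quant Delta (x + u) - x)\<^sup>2 = t\<^sup>2 + (Delta\<^sup>2 - 2 * t * Delta) * indicator I u"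
      using e by eventually_elim (erule ssubst, simp add: indicator_def power2_eq_square algebra_simps)
  qed auto
  also have "\<dots> = t * (Delta - t)" using int D U.prob_space by (simp add: PI power2_eq_square field_simps)
  also have "\<dots> \<le> Delta\<^sup>2 / 4"
    using zero_le_power2[of "t - Delta / 2"] by (simp add: power2_eq_square algebra_simps)
  finally show "(\<integral>u. (quant Delta (x + u) - x)\<^sup>2 \<partial>U) \<le> Delta\<^sup>2 / 4" .
qed

end

subsection \<open>A maximal inequality\<close>

text \<open>Ville's inequality. The supermartingale property is an inequality of integrals over past
  events, which is the form the one-step estimates take. The proof stops the process when it reaches
  \<open>c\<close>.\<close>

lemma (in prob_space) supermartingale_maximal_inequality:
  fixes V :: "nat \<Rightarrow> 'a \<Rightarrow> real" and F :: "nat \<Rightarrow> 'a measure"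
  assumes sub: "\<And>j. subalgebra M (F j)" and mono: "\<And>j. sets (F j) \<subseteq> sets (F (Suc j))"
    and meas: "\<And>j. V j \<in> borel_measurable (F j)" and int: "\<And>j. integrable M (V j)"
    and nonneg: "\<And>j w. w \<in> space M \<Longrightarrow> 0 \<le> V j w"
    and step: "\<And>j G. G \<in> sets (F j) \<Longrightarrow>
      expectation (\<lambda>w. indicator G w * V (Suc j) w) \<le> expectation (\<lambda>w. indicator G w * V j w)"
    and c: "c > 0"
  shows "{w \<in> space M. \<exists>j. c \<le> V j w} \<in> events"
    and "prob {w \<in> space M. \<exists>j. c \<le> V j w} \<le> expectation (V 0) / c"
proof -
  define T where "T n = {w \<in> space M. \<exists>j\<le>n. c \<le> V j w}" for n
  have spF: "space (F j) = space M" for j using sub by (simp add: subalgebra_def)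
  have ex: "{w \<in> space M. c \<le> V j w} \<in> sets (F j)" for j
  proof -
    have "{w \<in> space (F j). c \<le> V j w} \<in> sets (F j)" using meas[of j] by measurable
    then show ?thesis by (simp add: spF)
  qed
  have TF: "T n \<in> sets (F n)" for n
  proof (induction n)
    case 0 then show ?case using ex[of 0] by (simp add: T_def)
  next
    case (Suc n)
    have "T (Suc n) = T n \<union> {w \<in> space M. c \<le> V (Suc n) w}"
      by (auto simp: T_def le_Suc_eq)
    then show ?case using Suc mono[of n] ex[of "Suc n"] by auto
  qed
  have T: "T n \<in> events" for n using TF[of n] sub[of n] by (auto simp: subalgebra_def)
  have intV: "integrable M (\<lambda>w. indicator G w * V j w)" if "G \<in> events" for G j
    using integrable_mult_indicator[OF that int[of j]] by simp
  have intI: "integrable M (\<lambda>w. c * indicator (T n) w)" for n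
    using T by (intro integrable_mult_right integrable_real_indicator) (auto simp: less_top[symmetric])
  \<comment> \<open>The left side is the mean of the stopped process, counted as \<open>c\<close>
    once \<open>c\<close> has been reached. Passing to the next time, points that newly reach
    \<open>c\<close> have value at least \<open>c\<close>; on the rest the step inequality applies,
    as the complement of \<open>T n\<close> is known at time \<open>n\<close>.\<close>
  have main: "c * prob (T n) + expectation (\<lambda>w. indicator (space M - T n) w * V n w) \<le> expectation (V 0)" for n
  proof (induction n)
    case 0
    have "c * prob (T 0) + expectation (\<lambda>w. indicator (space M - T 0) w * V 0 w)
        = expectation (\<lambda>w. c * indicator (T 0) w + indicator (space M - T 0) w * V 0 w)"
      using T by (subst Bochner_Integration.integral_add[OF intI intV]) auto
    also have "\<dots> \<le> expectation (V 0)"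
    proof (intro integral_mono Bochner_Integration.integrable_add intI intV int)
      fix w assume "w \<in> space M"
      then show "c * indicator (T 0) w + indicator (space M - T 0) w * V 0 w \<le> V 0 w"
        by (auto simp: T_def indicator_def)
    qed (use T in auto)
    finally show ?case .
  next
    case (Suc n)
    have "c * prob (T (Suc n)) + expectation (\<lambda>w. indicator (space M - T (Suc n)) w * V (Suc n) w)
        = expectation (\<lambda>w. c * indicator (T (Suc n)) w + indicator (space M - T (Suc n)) w * V (Suc n) w)"
      using T by (subst Bochner_Integration.integral_add[OF intI intV]) auto
    also have "\<dots> \<le> expectation (\<lambda>w. c * indicator (T n) w + indicator (space M - T n) w * V (Suc n) w)"
    proof (intro integral_mono Bochner_Integration.integrable_add intI intV)
      fix w assume w: "w \<in> space M"
      have "T n \<subseteq> T (Suc n)" unfolding T_def using le_SucI by blast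
      moreover have "c \<le> V (Suc n) w" if "w \<in> T (Suc n)" "w \<notin> T n"
        using that by (auto simp: T_def le_Suc_eq)
      ultimately show "c * indicator (T (Suc n)) w + indicator (space M - T (Suc n)) w * V (Suc n) w
        \<le> c * indicator (T n) w + indicator (space M - T n) w * V (Suc n) w"
        using w by (auto simp: indicator_def)
    qed (use T in auto)
    also have "\<dots> = c * prob (T n) + expectation (\<lambda>w. indicator (space M - T n) w * V (Suc n) w)"
      using T by (subst Bochner_Integration.integral_add[OF intI intV]) auto
    also have "\<dots> \<le> c * prob (T n) + expectation (\<lambda>w. indicator (space M - T n) w * V n w)"
      by (intro add_left_mono step) (metis TF sets.compl_sets spF)
    finally show ?case using Suc by linarith
  qed
  have bnd: "prob (T n) \<le> expectation (V 0) / c" for n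
  proof -
    have "0 \<le> expectation (\<lambda>w. indicator (space M - T n) w * V n w)"
      by (intro Bochner_Integration.integral_nonneg_AE AE_I2) (auto simp: nonneg)
    then show ?thesis using main[of n] c by (simp add: field_simps)
  qed
  have U: "{w \<in> space M. \<exists>j. c \<le> V j w} = (\<Union>n. T n)" by (auto simp: T_def)
  show "{w \<in> space M. \<exists>j. c \<le> V j w} \<in> events" unfolding U using T by auto
  have "incseq T" unfolding T_def by (intro incseq_SucI) (use le_SucI in blast)
  then have "(\<lambda>n. prob (T n)) \<longlonglongrightarrow> prob (\<Union>n. T n)"
    using T by (intro finite_Lim_measure_incseq) auto
  then show "prob {w \<in> space M. \<exists>j. c \<le> V j w} \<le> expectation (V 0) / c"
    unfolding U using bnd by (intro LIMSEQ_le_const2) auto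
qed

subsection \<open>Essentially bounded random variables\<close>

text \<open>The law of a dither confines it to its interval only almost everywhere, so pointwise
  bounds are out of reach. This class is closed under the ring operations and finite sums, and its
  members are integrable.\<close>

definition ess_bounded :: "'a measure \<Rightarrow> ('a \<Rightarrow> real) \<Rightarrow> bool" where
  "ess_bounded M f \<longleftrightarrow> f \<in> borel_measurable M \<and> (\<exists>C. AE w in M. \<bar>f w\<bar> \<le> C)"

named_theorems ebd

lemma (in prob_space) ess_bounded_integrable:
  "ess_bounded M f \<Longrightarrow> integrable M f"
  unfolding ess_bounded_def by (auto intro!: integrable_const_bound)

lemma ess_bounded_const [ebd]: "ess_bounded M (\<lambda>_. c)"
  unfolding ess_bounded_def by auto

lemma ess_bounded_indicator [ebd]: "G \<in> sets M \<Longrightarrow> ess_bounded M (indicator G)"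
  unfolding ess_bounded_def by (auto intro!: exI[of _ 1] simp: indicator_def)

lemma ess_bounded_add [ebd]:
  assumes "ess_bounded M f" "ess_bounded M g"
  shows "ess_bounded M (\<lambda>w. f w + g w)"
proof -
  obtain C D where "AE w in M. \<bar>f w\<bar> \<le> C" "AE w in M. \<bar>g w\<bar> \<le> D"
    using assms by (auto simp: ess_bounded_def)
  then have "AE w in M. \<bar>f w + g w\<bar> \<le> C + D" by eventually_elim linarith
  then show ?thesis using assms by (auto simp: ess_bounded_def)
qed

lemma ess_bounded_mult [ebd]:
  assumes "ess_bounded M f" "ess_bounded M g"
  shows "ess_bounded M (\<lambda>w. f w * g w)"
proof -
  obtain C D where "AE w in M. \<bar>f w\<bar> \<le> C" "AE w in M. \<bar>g w\<bar> \<le> D"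
    using assms by (auto simp: ess_bounded_def)
  then have "AE w in M. \<bar>f w * g w\<bar> \<le> C * D"
    by eventually_elim (simp add: abs_mult mult_mono')
  then show ?thesis using assms by (auto simp: ess_bounded_def)
qed

lemma ess_bounded_minus [ebd]: "ess_bounded M f \<Longrightarrow> ess_bounded M (\<lambda>w. - f w)"
  using ess_bounded_mult[OF ess_bounded_const[of M "-1"]] by auto

lemma ess_bounded_diff [ebd]:
  "ess_bounded M f \<Longrightarrow> ess_bounded M g \<Longrightarrow> ess_bounded M (\<lambda>w. f w - g w)"
  using ess_bounded_add[OF _ ess_bounded_minus] by auto

lemma ess_bounded_sum [ebd]:
  "(\<And>i. i \<in> I \<Longrightarrow> ess_bounded M (f i)) \<Longrightarrow> ess_bounded M (\<lambda>w. \<Sum>i\<in>I. f i w)"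
  by (induction I rule: infinite_finite_induct) (auto intro: ebd)

lemma sum_UNIV_prod:
  "(\<Sum>p\<in>UNIV. f p) = (\<Sum>n\<in>(UNIV::'n::finite set). \<Sum>l\<in>(UNIV::'m::finite set). f (n, l))"
  by (simp add: sum.cartesian_product flip: UNIV_Times_UNIV)

subsection \<open>The network\<close>

text \<open>Index set of the independent sources of randomness: \<open>Inl i\<close> is the whole
  graph at time \<open>i\<close>, leaving its edges free to be correlated, and
  \<open>Inr (i, n, l)\<close> is one dither.\<close>

type_synonym 'n source = "nat + nat \<times> 'n \<times> 'n"

locale qc_network = prob_space M for M :: "'a measure" +
  fixes Adj :: "nat \<Rightarrow> 'a \<Rightarrow> 'n::finite \<Rightarrow> 'n \<Rightarrow> bool"
    and nu :: "nat \<Rightarrow> 'n \<Rightarrow> 'n \<Rightarrow> 'a \<Rightarrow> real"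
    and alpha :: "nat \<Rightarrow> real" and Delta :: real and x0 :: "real^'n"
  assumes graph_sym: "\<And>i w n l. w \<in> space M \<Longrightarrow> Adj i w n l = Adj i w l n"
    and graph_irrefl: "\<And>i w n. w \<in> space M \<Longrightarrow> \<not> Adj i w n n"
    and graph_meas: "\<And>i. Adj i \<in> measurable M (count_space UNIV)"
    and graph_ident: "\<And>i. distr M (count_space UNIV) (Adj i) = distr M (count_space UNIV) (Adj 0)"
    and nu_meas: "\<And>i n l. nu i n l \<in> borel_measurable M"
    and nu_unif: "\<And>i n l. distr M lborel (nu i n l) = uniform_measure lborel {- Delta / 2 ..< Delta / 2}"
    and indep: "indep_sets
          (\<lambda>k. case k of
                 Inl i \<Rightarrow> {Adj i -` A \<inter> space M | A. A \<in> sets (count_space UNIV)}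
               | Inr (i, n, l) \<Rightarrow> {nu i n l -` B \<inter> space M | B. B \<in> sets borel})
          UNIV"
    and Delta_pos: "Delta > 0"
begin

section \<open>Sigma-algebras generated by sets of sources\<close>

definition gen :: "'n source \<Rightarrow> 'a set set" where
  "gen k = (case k of
                 Inl i \<Rightarrow> {Adj i -` A \<inter> space M | A. A \<in> sets (count_space UNIV)}
               | Inr (i, n, l) \<Rightarrow> {nu i n l -` B \<inter> space M | B. B \<in> sets borel})"

definition FF :: "'n source set \<Rightarrow> 'a measure" where
  "FF J = sigma (space M) (\<Union>k\<in>J. gen k)"

text \<open>The inequality is strict: the state at time \<open>i\<close> is a function of these
  sources, while the graph and the dithers of time \<open>i\<close> are still fresh.\<close>

definition past :: "nat \<Rightarrow> 'n source set" where
  "past i = {k. case k of Inl j \<Rightarrow> j < i | Inr (j, n, l) \<Rightarrow> j < i}"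

lemma gen_indep: "indep_sets gen UNIV"
  using indep unfolding gen_def[abs_def] .

lemma gen_events: "gen k \<subseteq> events"
  using gen_indep by (auto simp: indep_sets_def)

lemma gen_Pow: "(\<Union>k\<in>J. gen k) \<subseteq> Pow (space M)"
  using gen_events sets.sets_into_space by blast

lemma space_FF [simp]: "space (FF J) = space M"
  by (simp add: FF_def gen_Pow space_measure_of)

lemma sets_FF: "sets (FF J) = sigma_sets (space M) (\<Union>k\<in>J. gen k)"
  by (simp add: FF_def gen_Pow)

lemma FF_sub: "sets (FF J) \<subseteq> events"
  unfolding sets_FF using gen_events by (intro sets.sigma_sets_subset) blast

lemma FF_mono: "J \<subseteq> K \<Longrightarrow> sets (FF J) \<subseteq> sets (FF K)"
  unfolding sets_FF by (intro sigma_sets_mono') auto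

lemma measurable_FF_mono: "f \<in> measurable (FF J) N \<Longrightarrow> J \<subseteq> K \<Longrightarrow> f \<in> measurable (FF K) N"
  using FF_mono[of J K] by (auto simp: measurable_def)

lemma measurable_FF: "f \<in> measurable (FF J) N \<Longrightarrow> f \<in> measurable M N"
  using FF_sub[of J] by (auto simp: measurable_def)

lemma gen_FF: "k \<in> J \<Longrightarrow> gen k \<subseteq> sets (FF J)"
  unfolding sets_FF by (auto intro: sigma_sets.Basic)

lemma Adj_FF: "Inl i \<in> J \<Longrightarrow> Adj i \<in> measurable (FF J) (count_space UNIV)"
  using gen_FF[of "Inl i" J] by (auto simp: measurable_def gen_def)

lemma nu_FF: "Inr (i, n, l) \<in> J \<Longrightarrow> nu i n l \<in> borel_measurable (FF J)"
  using gen_FF[of "Inr (i, n, l)" J] by (auto simp: measurable_def gen_def)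

text \<open>Needed to pass from independent generators to independent generated sigma-algebras;
  preimages of a sigma-algebra are closed under intersection.\<close>

lemma gen_Int_stable: "Int_stable (gen k)"
proof -
  have pre: "Int_stable {f -` A \<inter> space M | A. A \<in> sets N}" for f :: "'a \<Rightarrow> 'b" and N
  proof (rule Int_stableI)
    fix a b assume "a \<in> {f -` A \<inter> space M | A. A \<in> sets N}" "b \<in> {f -` A \<inter> space M | A. A \<in> sets N}"
    then obtain A B where "a = f -` A \<inter> space M" "b = f -` B \<inter> space M" "A \<in> sets N" "B \<in> sets N" by blast
    then have "a \<inter> b = f -` (A \<inter> B) \<inter> space M" "A \<inter> B \<in> sets N" by auto
    then show "a \<inter> b \<in> {f -` A \<inter> space M | A. A \<in> sets N}" by blast
  qed
  show ?thesis
  proof (cases k)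
    case (Inl i)
    then show ?thesis using pre[of "Adj i" "count_space UNIV"] by (simp add: gen_def)
  next
    case (Inr p)
    then show ?thesis by (cases p) (simp add: gen_def pre)
  qed
qed

text \<open>Disjoint groups of independent intersection-stable families generate independent
  sigma-algebras.\<close>

lemma FF_indep: "k \<notin> J \<Longrightarrow> indep_set (sets (FF J)) (sets (FF {k}))"
proof -
  assume k: "k \<notin> J"
  have "indep_sets (\<lambda>j. sigma_sets (space M) (\<Union>i\<in>case_bool J {k} j. gen i)) UNIV"
  proof (rule indep_sets_collect_sigma)
    show "indep_sets gen (\<Union>j\<in>UNIV. case_bool J {k} j)"
      using gen_indep by (rule indep_sets_mono_index[rotated]) simp
    show "disjoint_family_on (case_bool J {k}) UNIV"
      using k by (auto simp: disjoint_family_on_def split: bool.splits)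
  qed (rule gen_Int_stable)
  then show ?thesis
    unfolding indep_set_def sets_FF
    by (rule indep_sets_mono) (auto split: bool.splits)
qed

lemma FF_indep_var:
  assumes "X \<in> measurable (FF J) N" "Y \<in> measurable (FF {k}) L" "k \<notin> J"
  shows "indep_var N X L Y"
  unfolding indep_var_eq
proof (intro conjI)
  show "random_variable N X" "random_variable L Y" using assms measurable_FF by blast+
  have "{X -` A \<inter> space M |A. A \<in> sets N} \<subseteq> sets (FF J)"
    using measurable_sets[OF assms(1)] by auto
  from sets.sigma_sets_subset[OF this]
  have "sigma_sets (space M) {X -` A \<inter> space M |A. A \<in> sets N} \<subseteq> sets (FF J)" by simp
  moreover have "{Y -` A \<inter> space M |A. A \<in> sets L} \<subseteq> sets (FF {k})"
    using measurable_sets[OF assms(2)] by auto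
  from sets.sigma_sets_subset[OF this]
  have "sigma_sets (space M) {Y -` A \<inter> space M |A. A \<in> sets L} \<subseteq> sets (FF {k})" by simp
  ultimately show "indep_set (sigma_sets (space M) {X -` A \<inter> space M |A. A \<in> sets N})
     (sigma_sets (space M) {Y -` A \<inter> space M |A. A \<in> sets L})"
    unfolding indep_set_def
    by (intro indep_sets_mono_sets[OF FF_indep[OF assms(3), unfolded indep_set_def]])
       (auto split: bool.splits)
qed

lemma past_notin: "Inl i \<notin> past i" "Inr (i, n, l) \<notin> past i"
  by (simp_all add: past_def)

lemma past_Suc: "past i \<subseteq> past (Suc i)" "Inl i \<in> past (Suc i)" "Inr (i, n, l) \<in> past (Suc i)"
  by (auto simp: past_def less_Suc_eq split: sum.split_asm sum.split)

text \<open>Both arguments of \<^const>\<open>indep_var\<close> have one value type, hence the dither is paired with 0.\<close>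
lemma noise_fubini:
  fixes h :: "real \<Rightarrow> real \<Rightarrow> real"
  assumes H1: "H1 \<in> borel_measurable (FF J)" "ess_bounded M H1" and H2: "H2 \<in> borel_measurable (FF J)"
    and k: "Inr (i, n, l) \<notin> J"
    and h: "case_prod h \<in> borel_measurable (borel \<Otimes>\<^sub>M borel)"
    and hb: "\<And>x u. u \<in> {- Delta / 2 ..< Delta / 2} \<Longrightarrow> \<bar>h x u\<bar> \<le> C"
  shows "expectation (\<lambda>w. H1 w * h (H2 w) (nu i n l w))
    = expectation (\<lambda>w. H1 w * (\<integral>u. h (H2 w) u \<partial>uniform_measure lborel {- Delta / 2 ..< Delta / 2}))"
    and "ess_bounded M (\<lambda>w. h (H2 w) (nu i n l w))"
proof -
  let ?U = "uniform_measure lborel {- Delta / 2 ..< Delta / 2}"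
  define X where "X w = (H1 w, H2 w)" for w
  define Y where "Y w = (nu i n l w, 0::real)" for w
  \<comment> \<open>\<open>H1\<close> and \<open>H2\<close> form one component, as they may depend
    on each other; only the dither is integrated out separately. The dummy second entry of
    \<open>Y\<close> is ignored.\<close>
  define F where "F p = fst (fst p) * h (snd (fst p)) (fst (snd p))" for p :: "(real \<times> real) \<times> (real \<times> real)"
  let ?B = "borel \<Otimes>\<^sub>M borel :: (real \<times> real) measure"
  note [measurable] = H1(1) H2
  have hm[measurable (raw)]: "(\<lambda>x. h (f x) (g x)) \<in> borel_measurable N"
    if "f \<in> borel_measurable N" "g \<in> borel_measurable N" for f g and N :: "'z measure"
    using measurable_compose[OF measurable_Pair[OF that] h] by simp
  have nuF: "nu i n l \<in> borel_measurable (FF {Inr (i, n, l)})" by (rule nu_FF) simp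
  have XF: "X \<in> measurable (FF J) ?B" unfolding X_def[abs_def] by measurable
  have YF: "Y \<in> measurable (FF {Inr (i, n, l)}) ?B"
    unfolding Y_def[abs_def] using nuF by (intro measurable_Pair) auto
  have ind: "indep_var ?B X ?B Y" by (rule FF_indep_var[OF XF YF k])
  note XM[measurable] = measurable_FF[OF XF] and YM[measurable] = measurable_FF[OF YF]
  note [measurable] = nu_meas measurable_FF[OF H1(1)] measurable_FF[OF H2]
  have dist: "distr M ?B X \<Otimes>\<^sub>M distr M ?B Y = distr M (?B \<Otimes>\<^sub>M ?B) (\<lambda>w. (X w, Y w))"
    using ind by (simp add: indep_var_distribution_eq)
  have rng: "AE w in M. nu i n l w \<in> {- Delta / 2 ..< Delta / 2}"
  proof -
    have "AE u in distr M lborel (nu i n l). u \<in> {- Delta / 2 ..< Delta / 2}"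
      unfolding nu_unif by (rule uniform_AE[OF Delta_pos refl])
    then show ?thesis by (subst (asm) AE_distr_iff) auto
  qed
  show eb: "ess_bounded M (\<lambda>w. h (H2 w) (nu i n l w))"
    unfolding ess_bounded_def
  proof
    have "AE w in M. \<bar>h (H2 w) (nu i n l w)\<bar> \<le> C" using rng by eventually_elim (rule hb)
    then show "\<exists>C. AE w in M. \<bar>h (H2 w) (nu i n l w)\<bar> \<le> C" by blast
  qed measurable
  have Fm[measurable]: "F \<in> borel_measurable (?B \<Otimes>\<^sub>M ?B)" unfolding F_def[abs_def] by measurable
  interpret DX: prob_space "distr M ?B X" by (rule prob_space_distr) simp
  interpret DY: prob_space "distr M ?B Y" by (rule prob_space_distr) simp
  interpret P: pair_sigma_finite "distr M ?B X" "distr M ?B Y" ..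
  have intF: "integrable (distr M ?B X \<Otimes>\<^sub>M distr M ?B Y) F"
    unfolding dist using ess_bounded_integrable[OF ess_bounded_mult[OF H1(2) eb]]
    by (subst integrable_distr_eq) (auto simp: F_def X_def Y_def)
  have "expectation (\<lambda>w. H1 w * h (H2 w) (nu i n l w)) = expectation (\<lambda>w. F (X w, Y w))"
    by (simp add: F_def X_def Y_def)
  also have "\<dots> = (\<integral>p. F p \<partial>(distr M ?B X \<Otimes>\<^sub>M distr M ?B Y))"
    unfolding dist by (subst integral_distr) auto
  also have "\<dots> = (\<integral>x. (\<integral>y. F (x, y) \<partial>distr M ?B Y) \<partial>distr M ?B X)"
    by (rule P.integral_fst'[OF intF, symmetric])
  also have "\<dots> = expectation (\<lambda>w. \<integral>y. F (X w, y) \<partial>distr M ?B Y)"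
    by (subst integral_distr) auto
  also have "\<dots> = expectation (\<lambda>w. H1 w * (\<integral>u. h (H2 w) u \<partial>?U))"
  proof (rule Bochner_Integration.integral_cong[OF refl])
    fix w
    have "(\<integral>y. F (X w, y) \<partial>distr M ?B Y) = expectation (\<lambda>v. H1 w * h (H2 w) (nu i n l v))"
      by (subst integral_distr) (auto simp: F_def X_def Y_def)
    also have "\<dots> = H1 w * (\<integral>u. h (H2 w) u \<partial>distr M lborel (nu i n l))"
      by (subst integral_distr) auto
    finally show "(\<integral>y. F (X w, y) \<partial>distr M ?B Y) = H1 w * (\<integral>u. h (H2 w) u \<partial>?U)"
      by (simp add: nu_unif)
  qed
  finally show "expectation (\<lambda>w. H1 w * h (H2 w) (nu i n l w))
    = expectation (\<lambda>w. H1 w * (\<integral>u. h (H2 w) u \<partial>?U))" .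
qed

end

section \<open>Algebra of Laplacians and quadratic forms\<close>

lemma laplacian_mult:
  assumes "\<And>n. \<not> G n n"
  shows "(laplacian G *v x) $ n = (\<Sum>l\<in>UNIV. if G n l then x $ n - x $ l else 0)"
proof -
  have "(laplacian G *v x) $ n =
      (\<Sum>l\<in>UNIV. (if n = l then real (card {k. G n k}) * x $ n else 0) - (if G n l then x $ l else 0))"
    by (simp add: laplacian_def matrix_vector_mult_def) (intro sum.cong refl, auto simp: assms)
  also have "\<dots> = real (card {k. G n k}) * x $ n - (\<Sum>l\<in>UNIV. if G n l then x $ l else 0)"
    by (simp add: sum_subtractf)
  also have "real (card {k. G n k}) * x $ n = (\<Sum>l\<in>UNIV. if G n l then x $ n else 0)"
    by (simp add: sum.If_cases)
  finally show ?thesis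
    by (simp add: sum_subtractf[symmetric]) (intro sum.cong refl, auto)
qed

text \<open>The terms linear in the noise \<open>h\<close> are collected into one product with
  \<open>x - a *\<^sub>R y\<close>, so that a single mean-zero argument removes them.\<close>

lemma quadratic_form_step:
  fixes B :: "real^'n^'n"
  assumes "transpose B = B"
  shows "(x - a *\<^sub>R y + a *\<^sub>R h) \<bullet> (B *v (x - a *\<^sub>R y + a *\<^sub>R h))
    = x \<bullet> (B *v x) - 2 * a * (x \<bullet> (B *v y)) + a\<^sup>2 * (y \<bullet> (B *v y))
      + 2 * a * (h \<bullet> (B *v (x - a *\<^sub>R y))) + a\<^sup>2 * (h \<bullet> (B *v h))"
proof -
  have s: "y \<bullet> (B *v x) = x \<bullet> (B *v y)" "x \<bullet> (B *v h) = h \<bullet> (B *v x)" "y \<bullet> (B *v h) = h \<bullet> (B *v y)"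
    using sym_mat_inner[OF assms] by (metis inner_commute)+
  show ?thesis
    by (simp add: matrix_vector_right_distrib matrix_vector_mult_diff_distrib matrix_vector_mult_scaleR
        inner_diff_left inner_diff_right inner_add_left inner_add_right s power2_eq_square algebra_simps)
qed

text \<open>In coordinates a quadratic form is a polynomial in real random variables, to which
  measurability, essential boundedness and linearity of expectation apply termwise.\<close>

lemma inner_mult_vec:
  fixes B :: "real^'n^'n"
  shows "x \<bullet> (B *v y) = (\<Sum>n\<in>UNIV. \<Sum>m\<in>UNIV. B $ n $ m * x $ n * y $ m)"
  by (simp add: inner_vec_def matrix_vector_mult_def sum_distrib_left mult_ac)

section \<open>One-step change of a quadratic form of the state\<close>

context qc_network
begin

abbreviation X :: "nat \<Rightarrow> 'a \<Rightarrow> real^'n" where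
  "X i w \<equiv> qc_state Delta alpha Adj nu x0 i w"

definition A :: "nat \<Rightarrow> 'n \<Rightarrow> 'n \<Rightarrow> 'a \<Rightarrow> real" where
  "A i n l w = (if Adj i w n l then 1 else 0)"

definition err :: "nat \<Rightarrow> 'n \<Rightarrow> 'n \<Rightarrow> 'a \<Rightarrow> real" where
  "err i n l w = quant Delta (X i w $ l + nu i n l w) - X i w $ l"

definition Lbar :: "real^'n^'n" where
  "Lbar = (\<chi> n l. expectation (\<lambda>w. laplacian (Adj 0 w) $ n $ l))"

text \<open>Ordered pairs, because the two directions of an edge use different dithers and each
  contributes its own variance.\<close>

definition arcs :: "('n \<times> 'n) set" where
  "arcs = {(n, l). n \<noteq> l \<and> prob {w \<in> space M. Adj 0 w n l} > 0}"

lemma graph_fun_FF: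
  fixes f :: "('n \<Rightarrow> 'n \<Rightarrow> bool) \<Rightarrow> real"
  shows "Inl i \<in> J \<Longrightarrow> (\<lambda>w. f (Adj i w)) \<in> borel_measurable (FF J)"
  by (rule measurable_compose[OF Adj_FF]) auto

lemma graph_fun_ebd [ebd]:
  fixes f :: "('n \<Rightarrow> 'n \<Rightarrow> bool) \<Rightarrow> real"
  shows "ess_bounded M (\<lambda>w. f (Adj i w))"
  unfolding ess_bounded_def
proof
  show "(\<lambda>w. f (Adj i w)) \<in> borel_measurable M"
    by (rule measurable_FF[OF graph_fun_FF[of i UNIV]]) simp
  \<comment> \<open>There are finitely many graphs on a finite node type.\<close>
  have "\<bar>f g\<bar> \<le> (\<Sum>g\<in>UNIV. \<bar>f g\<bar>)" for g by (rule member_le_sum) auto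
  then show "\<exists>C. AE w in M. \<bar>f (Adj i w)\<bar> \<le> C" by blast
qed

lemma graph_fun_expectation:
  fixes f :: "('n \<Rightarrow> 'n \<Rightarrow> bool) \<Rightarrow> real"
  shows "expectation (\<lambda>w. f (Adj i w)) = expectation (\<lambda>w. f (Adj 0 w))"
proof -
  have "expectation (\<lambda>w. f (Adj j w)) = (\<integral>g. f g \<partial>distr M (count_space UNIV) (Adj j))" for j
    using graph_meas by (subst integral_distr) auto
  then show ?thesis using graph_ident[of i] by simp
qed

lemma A_FF: "Inl i \<in> J \<Longrightarrow> A i n l \<in> borel_measurable (FF J)"
  unfolding A_def[abs_def] by (rule graph_fun_FF[of i J "\<lambda>g. if g n l then 1 else 0"])

lemma A_ebd [ebd]: "ess_bounded M (A i n l)"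
  unfolding A_def[abs_def] by (rule graph_fun_ebd[of "\<lambda>g. if g n l then 1 else 0"])

lemma X_Suc_component:
  "X (Suc i) w $ n = (1 - alpha i * (\<Sum>l\<in>UNIV. A i n l w)) * X i w $ n
     + alpha i * (\<Sum>l\<in>UNIV. A i n l w * (X i w $ l + err i n l w))"
proof -
  have "real (card {l. Adj i w n l}) = (\<Sum>l\<in>UNIV. A i n l w)"
    by (simp add: A_def sum.If_cases)
  moreover have "(\<Sum>l\<in>{l. Adj i w n l}. quant Delta (X i w $ l + nu i n l w))
      = (\<Sum>l\<in>UNIV. A i n l w * (X i w $ l + err i n l w))"
    by (rule sum.mono_neutral_cong_left) (auto simp: A_def err_def)
  ultimately show ?thesis by simp
qed

lemma X_Suc:
  assumes "w \<in> space M"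
  shows "X (Suc i) w = X i w - alpha i *\<^sub>R (laplacian (Adj i w) *v X i w)
     + alpha i *\<^sub>R (\<chi> n. \<Sum>l\<in>UNIV. A i n l w * err i n l w)"
proof -
  have "(laplacian (Adj i w) *v X i w) $ n
      = (\<Sum>l\<in>UNIV. A i n l w) * X i w $ n - (\<Sum>l\<in>UNIV. A i n l w * X i w $ l)" for n
  proof -
    have "(laplacian (Adj i w) *v X i w) $ n = (\<Sum>l\<in>UNIV. A i n l w * X i w $ n - A i n l w * X i w $ l)"
      using graph_irrefl[OF assms] by (subst laplacian_mult) (auto simp: A_def intro: sum.cong)
    then show ?thesis by (simp add: sum_subtractf sum_distrib_right)
  qed
  then show ?thesis
    unfolding vec_eq_iff X_Suc_component by (simp add: distrib_left sum.distrib left_diff_distrib right_diff_distrib)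
qed

lemma X_FF: "(\<lambda>w. X i w $ n) \<in> borel_measurable (FF (past i))"
proof (induction i arbitrary: n)
  case (Suc i)
  have [measurable]: "(\<lambda>w. X i w $ n) \<in> borel_measurable (FF (past (Suc i)))" for n
    using measurable_FF_mono[OF Suc past_Suc(1)] .
  have [measurable]: "A i n l \<in> borel_measurable (FF (past (Suc i)))" for n l
    by (rule A_FF) (rule past_Suc)
  have [measurable]: "nu i n l \<in> borel_measurable (FF (past (Suc i)))" for n l
    by (rule nu_FF) (rule past_Suc)
  note [measurable] = quant_measurable[OF Delta_pos]
  show ?case unfolding X_Suc_component err_def by measurable
qed simp

lemma err_bound: "u \<in> {- Delta / 2 ..< Delta / 2} \<Longrightarrow> \<bar>quant Delta (x + u) - x\<bar> \<le> Delta"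
  using quant_error_two_point[OF Delta_pos, of u x] by (auto simp: indicator_def split: if_splits)

text \<open>The dither in question is independent of \<open>FF J\<close>, while the state is
  measurable there, so integrating the dither out leaves the moments of the quantizer error.
  \<open>J\<close> may also contain the current graph and other dithers of the same time.\<close>

lemma err_facts:
  assumes H: "H \<in> borel_measurable (FF J)" "ess_bounded M H"
    and k: "past i \<subseteq> J" "Inr (i, n, l) \<notin> J"
  shows "expectation (\<lambda>w. H w * err i n l w) = 0"
    and "(\<And>w. w \<in> space M \<Longrightarrow> 0 \<le> H w) \<Longrightarrow>
      expectation (\<lambda>w. H w * (err i n l w)\<^sup>2) \<le> Delta\<^sup>2 / 4 * expectation H"
proof -
  note [measurable] = quant_measurable[OF Delta_pos]
  have XJ: "(\<lambda>w. X i w $ l) \<in> borel_measurable (FF J)" by (rule measurable_FF_mono[OF X_FF k(1)])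
  have "expectation (\<lambda>w. H w * err i n l w)
      = expectation (\<lambda>w. H w * (\<integral>u. quant Delta (X i w $ l + u) - X i w $ l \<partial>uniform_measure lborel {- Delta / 2 ..< Delta / 2}))"
    unfolding err_def
    by (rule noise_fubini[OF H XJ k(2), where h = "\<lambda>x u. quant Delta (x + u) - x"])
       (measurable, rule err_bound)
  then show "expectation (\<lambda>w. H w * err i n l w) = 0"
    using quant_error_integral(1)[OF Delta_pos refl] by simp
  assume nn: "\<And>w. w \<in> space M \<Longrightarrow> 0 \<le> H w"
  let ?v = "\<lambda>x. \<integral>u. (quant Delta (x + u) - x)\<^sup>2 \<partial>uniform_measure lborel {- Delta / 2 ..< Delta / 2}"
  have "expectation (\<lambda>w. H w * (err i n l w)\<^sup>2) = expectation (\<lambda>w. H w * ?v (X i w $ l))"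
    unfolding err_def
    by (rule noise_fubini[OF H XJ k(2), where h = "\<lambda>x u. (quant Delta (x + u) - x)\<^sup>2" and C = "Delta\<^sup>2"])
       (measurable, metis err_bound abs_le_square_iff abs_of_pos Delta_pos abs_power2)
  also have "\<dots> \<le> expectation (\<lambda>w. H w * (Delta\<^sup>2 / 4))"
  proof (rule integral_mono')
    show "integrable M (\<lambda>w. H w * (Delta\<^sup>2 / 4))"
      using ess_bounded_integrable[OF H(2)] by simp
    fix w assume "w \<in> space M"
    then show "H w * ?v (X i w $ l) \<le> H w * (Delta\<^sup>2 / 4)" "0 \<le> H w * (Delta\<^sup>2 / 4)"
      using mult_left_mono[OF quant_error_integral(2)[OF Delta_pos refl] nn] nn by simp_all
  qed
  finally show "expectation (\<lambda>w. H w * (err i n l w)\<^sup>2) \<le> Delta\<^sup>2 / 4 * expectation H" by (simp add: mult.commute)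
qed

lemma err_ebd [ebd]: "ess_bounded M (err i n l)"
proof -
  note [measurable] = quant_measurable[OF Delta_pos]
  show ?thesis
    unfolding err_def[abs_def]
    by (rule noise_fubini(2)[OF _ ess_bounded_const X_FF past_notin(2), where h = "\<lambda>x u. quant Delta (x + u) - x"])
       (measurable, rule err_bound)
qed

lemma X_ebd [ebd]: "ess_bounded M (\<lambda>w. X i w $ n)"
proof (induction i arbitrary: n)
  case (Suc i)
  show ?case unfolding X_Suc_component by (intro ebd Suc)
qed (auto intro: ebd)

lemma err_FF: "Inr (i, n, l) \<in> J \<Longrightarrow> past i \<subseteq> J \<Longrightarrow> err i n l \<in> borel_measurable (FF J)"
proof -
  assume J: "Inr (i, n, l) \<in> J" "past i \<subseteq> J"
  note [measurable] = quant_measurable[OF Delta_pos] measurable_FF_mono[OF X_FF J(2)] nu_FF[OF J(1)]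
  show ?thesis unfolding err_def[abs_def] by measurable
qed

text \<open>Independence of the current graph from the past factors the expectation; equality in law
  with the graph at time 0 turns the mean into \<open>Lbar\<close>.\<close>

lemma laplacian_indep:
  assumes "H \<in> borel_measurable (FF (past i))" "ess_bounded M H"
  shows "expectation (\<lambda>w. H w * laplacian (Adj i w) $ m $ k) = expectation H * Lbar $ m $ k"
proof -
  have "(\<lambda>w. laplacian (Adj i w) $ m $ k) \<in> borel_measurable (FF {Inl i})"
    by (rule graph_fun_FF) simp
  from FF_indep_var[OF assms(1) this past_notin(1)]
  have "expectation (\<lambda>w. H w * laplacian (Adj i w) $ m $ k)
      = expectation H * expectation (\<lambda>w. laplacian (Adj i w) $ m $ k)"
    by (rule indep_var_lebesgue_integral) (intro ess_bounded_integrable assms graph_fun_ebd)+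
  then show ?thesis by (simp add: Lbar_def graph_fun_expectation[of "\<lambda>g. laplacian g $ m $ k" i])
qed

text \<open>The Laplacian enters linearly with coefficients known from the past, so it may be
  averaged entry by entry.\<close>

lemma drift_expectation:
  fixes B :: "real^'n^'n"
  assumes G: "G \<in> sets (FF (past i))"
  shows "expectation (\<lambda>w. indicator G w * (X i w \<bullet> (B *v (laplacian (Adj i w) *v X i w))))
    = expectation (\<lambda>w. indicator G w * (X i w \<bullet> (B *v (Lbar *v X i w))))"
proof -
  have GM: "G \<in> events" using G FF_sub by blast
  define H where "H n k w = (indicator G w :: real) * (X i w $ n * X i w $ k)" for n k w
  note [measurable] = X_FF G
  have H: "H n k \<in> borel_measurable (FF (past i))" "ess_bounded M (H n k)" for n k
    unfolding H_def[abs_def] by measurable (intro ebd GM)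
  have ex: "indicator G w * (X i w \<bullet> (B *v (L *v X i w)))
      = (\<Sum>n\<in>UNIV. \<Sum>m\<in>UNIV. \<Sum>k\<in>UNIV. B $ n $ m * (H n k w * L $ m $ k))" for L :: "real^'n^'n" and w
    unfolding inner_mult_vec H_def
    by (simp add: matrix_vector_mult_def sum_distrib_left mult_ac)
  have "expectation (\<lambda>w. H n k w * laplacian (Adj i w) $ m $ k) = expectation (\<lambda>w. H n k w * Lbar $ m $ k)" for n m k
    using laplacian_indep[OF H] by simp
  moreover have "integrable M (\<lambda>w. H n k w * laplacian (Adj i w) $ m $ k)" for n m k
    by (intro ess_bounded_integrable ebd H)
  moreover have "integrable M (\<lambda>w. H n k w * Lbar $ m $ k)" for n m k
    by (intro ess_bounded_integrable ebd H)
  ultimately show ?thesis unfolding ex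
    by (simp add: Bochner_Integration.integral_sum)
qed

lemma noise_cross_expectation:
  fixes B :: "real^'n^'n"
  assumes G: "G \<in> sets (FF (past i))"
  shows "expectation (\<lambda>w. indicator G w * ((\<chi> n. \<Sum>l\<in>UNIV. A i n l w * err i n l w)
      \<bullet> (B *v (X i w - c *\<^sub>R (laplacian (Adj i w) *v X i w))))) = 0"
proof -
  \<comment> \<open>The current graph joins the past since it occurs both in the noise weights and
    in the drift; the dithers of time \<open>i\<close> stay outside.\<close>
  define J where "J = insert (Inl i) (past i)"
  have J: "past i \<subseteq> J" "Inl i \<in> J" "Inr (i, n, l) \<notin> J" for n l
    using past_notin by (auto simp: J_def)
  have GM: "G \<in> events" and [measurable]: "G \<in> sets (FF J)" using G FF_sub FF_mono[OF J(1)] by blast+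
  define y where "y n w = (\<Sum>m\<in>UNIV. B $ n $ m * (X i w $ m
      - c * (\<Sum>k\<in>UNIV. laplacian (Adj i w) $ m $ k * X i w $ k)))" for n w
  define H where "H n l w = (indicator G w :: real) * (A i n l w * y n w)" for n l w
  note [measurable] = measurable_FF_mono[OF X_FF J(1)] A_FF[OF J(2)]
    graph_fun_FF[OF J(2), of "\<lambda>g. laplacian g $ m $ k" for m k]
  have H: "H n l \<in> borel_measurable (FF J)" "ess_bounded M (H n l)" for n l
    unfolding H_def[abs_def] y_def by measurable (intro ebd GM)
  have ex: "indicator G w * ((\<chi> n. \<Sum>l\<in>UNIV. A i n l w * err i n l w)
      \<bullet> (B *v (X i w - c *\<^sub>R (laplacian (Adj i w) *v X i w))))
      = (\<Sum>n\<in>UNIV. \<Sum>l\<in>UNIV. H n l w * err i n l w)" for w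
  proof -
    have "(B *v (X i w - c *\<^sub>R (laplacian (Adj i w) *v X i w))) $ n = y n w" for n
      by (simp add: matrix_vector_mult_def y_def)
    then show ?thesis
      by (simp add: inner_vec_def H_def sum_distrib_left sum_distrib_right mult_ac)
  qed
  have "integrable M (\<lambda>w. H n l w * err i n l w)" for n l
    by (intro ess_bounded_integrable ebd H)
  then show ?thesis unfolding ex
    using err_facts(1)[OF H J(1,3)] by (simp add: Bochner_Integration.integral_sum)
qed

text \<open>Confines the noise to realizable edges: outside \<open>arcs\<close> the weight is zero
  almost surely.\<close>

lemma A_expectation_le:
  assumes G: "G \<in> events"
  shows "expectation (\<lambda>w. indicator G w * A i n l w) \<le> (if (n, l) \<in> arcs then prob G else 0)"
proof (cases "(n, l) \<in> arcs")
  case True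
  have "expectation (\<lambda>w. indicator G w * A i n l w) \<le> expectation (indicator G)"
    using G by (intro integral_mono ess_bounded_integrable ebd) (auto simp: A_def indicator_def)
  then show ?thesis using True G by simp
next
  case False
  have "expectation (\<lambda>w. indicator G w * A i n l w) \<le> expectation (A i n l)"
    using G by (intro integral_mono ess_bounded_integrable ebd) (auto simp: A_def indicator_def)
  also have "\<dots> = expectation (A 0 n l)"
    unfolding A_def[abs_def] by (rule graph_fun_expectation[of "\<lambda>g. if g n l then 1 else 0"])
  also have "\<dots> = expectation (indicator {w \<in> space M. Adj 0 w n l})"
    by (intro Bochner_Integration.integral_cong) (auto simp: A_def)
  also have "\<dots> = prob {w \<in> space M. Adj 0 w n l}"
    by (simp add: Int_absorb2)
  also have "\<dots> \<le> 0"
  proof (cases "n = l")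
    case True
    then have "{w \<in> space M. Adj 0 w n l} = {}" using graph_irrefl by auto
    then show ?thesis by (simp only: measure_empty)
  qed (use False in \<open>auto simp: arcs_def not_less\<close>)
  finally show ?thesis using False by simp
qed

text \<open>Errors on distinct arcs are uncorrelated, even when they share a node. Only products of
  an arc with itself survive, hence only diagonal entries of \<open>B\<close>, each with a variance
  of at most \<open>Delta^2 / 4\<close>.\<close>

lemma noise_quadratic_expectation:
  fixes B :: "real^'n^'n"
  assumes G: "G \<in> sets (FF (past i))" and B: "\<And>n. 0 \<le> B $ n $ n" "\<And>n. B $ n $ n \<le> b"
  defines "h \<equiv> \<lambda>w. \<chi> n. \<Sum>l\<in>UNIV. A i n l w * err i n l w"
  shows "expectation (\<lambda>w. indicator G w * (h w \<bullet> (B *v h w))) \<le> b * (Delta\<^sup>2 / 4) * real (card arcs) * prob G"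
proof -
  have GM: "G \<in> events" using G FF_sub by blast
  define a where "a p w = A i (fst p) (snd p) w * err i (fst p) (snd p) w" for p w
  have aebd: "ess_bounded M (a p)" for p unfolding a_def[abs_def] by (intro ebd)
  have off: "expectation (\<lambda>w. indicator G w * (a p w * a q w)) = 0" if "p \<noteq> q" for p q
  proof -
    \<comment> \<open>The dither of \<open>q\<close> is included and that of \<open>p\<close> is
      not: the error on \<open>q\<close> becomes part of the coefficient against which the error on
      \<open>p\<close> averages to zero.\<close>
    define J where "J = insert (Inl i) (insert (Inr (i, fst q, snd q)) (past i))"
    have J: "past i \<subseteq> J" "Inl i \<in> J" "Inr (i, fst q, snd q) \<in> J" "Inr (i, fst p, snd p) \<notin> J"
      using that by (auto simp: J_def past_def prod_eq_iff split: prod.splits)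
    have [measurable]: "G \<in> sets (FF J)" using G FF_mono[OF J(1)] by blast
    define H where "H w = (indicator G w :: real) * (A i (fst p) (snd p) w * a q w)" for w
    note [measurable] = A_FF[OF J(2)] err_FF[OF J(3,1)]
    have H: "H \<in> borel_measurable (FF J)" "ess_bounded M H"
      unfolding H_def[abs_def] a_def by measurable (intro ebd GM)
    have "(\<lambda>w. indicator G w * (a p w * a q w)) = (\<lambda>w. H w * err i (fst p) (snd p) w)"
      by (simp add: H_def a_def mult_ac fun_eq_iff)
    then show ?thesis using err_facts(1)[OF H J(1,4)] by simp
  qed
  have diag: "expectation (\<lambda>w. indicator G w * (a p w * a p w))
      \<le> (if p \<in> arcs then Delta\<^sup>2 / 4 * prob G else 0)" for p
  proof -
    define J where "J = insert (Inl i) (past i)"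
    have J: "past i \<subseteq> J" "Inl i \<in> J" "Inr (i, fst p, snd p) \<notin> J"
      by (auto simp: J_def past_def split: prod.splits)
    have [measurable]: "G \<in> sets (FF J)" using G FF_mono[OF J(1)] by blast
    define H where "H w = (indicator G w :: real) * A i (fst p) (snd p) w" for w
    note [measurable] = A_FF[OF J(2)]
    have H: "H \<in> borel_measurable (FF J)" "ess_bounded M H"
      unfolding H_def[abs_def] by measurable (intro ebd GM)
    \<comment> \<open>A weight in {0, 1} equals its square, so it stays to the first power in the
      coefficient of the squared error.\<close>
    have "(\<lambda>w. indicator G w * (a p w * a p w)) = (\<lambda>w. H w * (err i (fst p) (snd p) w)\<^sup>2)"
      by (simp add: H_def a_def A_def fun_eq_iff power2_eq_square)
    then have "expectation (\<lambda>w. indicator G w * (a p w * a p w)) \<le> Delta\<^sup>2 / 4 * expectation H"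
      using err_facts(2)[OF H J(1,3)] by (simp add: H_def A_def)
    also have "\<dots> \<le> Delta\<^sup>2 / 4 * (if p \<in> arcs then prob G else 0)"
      using A_expectation_le[OF GM, of i "fst p" "snd p"] by (intro mult_left_mono) (auto simp: H_def[abs_def])
    finally show ?thesis by (auto split: if_splits)
  qed
  have "h w \<bullet> (B *v h w) = (\<Sum>n\<in>UNIV. \<Sum>l\<in>UNIV. \<Sum>m\<in>UNIV. \<Sum>k\<in>UNIV. B $ n $ m * (a (n, l) w * a (m, k) w))" for w
  proof -
    have "h w \<bullet> (B *v h w) = (\<Sum>n\<in>UNIV. \<Sum>m\<in>UNIV. \<Sum>l\<in>UNIV. \<Sum>k\<in>UNIV. B $ n $ m * (a (n, l) w * a (m, k) w))"
      unfolding inner_mult_vec h_def a_def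
      by (simp add: sum_distrib_left sum_distrib_right mult_ac) 
    also have "\<dots> = (\<Sum>n\<in>UNIV. \<Sum>l\<in>UNIV. \<Sum>m\<in>UNIV. \<Sum>k\<in>UNIV. B $ n $ m * (a (n, l) w * a (m, k) w))"
      by (intro sum.cong refl sum.swap)
    finally show ?thesis .
  qed
  then have ex: "indicator G w * (h w \<bullet> (B *v h w))
      = (\<Sum>p\<in>UNIV. \<Sum>q\<in>UNIV. B $ fst p $ fst q * (indicator G w * (a p w * a q w)))" for w
    by (simp add: sum_UNIV_prod sum_distrib_left mult_ac)
  have int: "integrable M (\<lambda>w. indicator G w * (a p w * a q w))" for p q
    by (intro ess_bounded_integrable ebd GM aebd)
  have "expectation (\<lambda>w. indicator G w * (h w \<bullet> (B *v h w)))
      = (\<Sum>p\<in>UNIV. \<Sum>q\<in>UNIV. B $ fst p $ fst q * expectation (\<lambda>w. indicator G w * (a p w * a q w)))"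
    unfolding ex using int by (simp add: Bochner_Integration.integral_sum)
  also have "\<dots> = (\<Sum>p\<in>UNIV. B $ fst p $ fst p * expectation (\<lambda>w. indicator G w * (a p w * a p w)))"
  proof (rule sum.cong[OF refl])
    fix p :: "'n \<times> 'n"
    show "(\<Sum>q\<in>UNIV. B $ fst p $ fst q * expectation (\<lambda>w. indicator G w * (a p w * a q w)))
      = B $ fst p $ fst p * expectation (\<lambda>w. indicator G w * (a p w * a p w))"
      by (subst sum.remove[of _ p]) (auto intro!: sum.neutral simp: off)
  qed
  also have "\<dots> \<le> (\<Sum>p\<in>UNIV. if p \<in> arcs then b * (Delta\<^sup>2 / 4 * prob G) else 0)"
  proof (rule sum_mono)
    fix p :: "'n \<times> 'n"
    have "B $ fst p $ fst p * expectation (\<lambda>w. indicator G w * (a p w * a p w))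
      \<le> B $ fst p $ fst p * (if p \<in> arcs then Delta\<^sup>2 / 4 * prob G else 0)"
      by (intro mult_left_mono diag B)
    also have "\<dots> \<le> b * (if p \<in> arcs then Delta\<^sup>2 / 4 * prob G else 0)"
      by (intro mult_right_mono B) auto
    finally show "B $ fst p $ fst p * expectation (\<lambda>w. indicator G w * (a p w * a p w))
      \<le> (if p \<in> arcs then b * (Delta\<^sup>2 / 4 * prob G) else 0)" by (auto split: if_splits)
  qed
  also have "\<dots> = b * (Delta\<^sup>2 / 4) * real (card arcs) * prob G"
    by (simp add: sum.If_cases)
  finally show ?thesis .
qed

lemma quadratic_FF: "(\<lambda>w. X i w \<bullet> (B *v X i w)) \<in> borel_measurable (FF (past i))"
proof -
  note [measurable] = X_FF
  show ?thesis unfolding inner_mult_vec by measurable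
qed

lemma quadratic_ebd [ebd]: "ess_bounded M (\<lambda>w. X i w \<bullet> (B *v X i w))"
  unfolding inner_mult_vec by (intro ebd)

lemma quadratic_one_step:
  fixes B :: "real^'n^'n"
  assumes G: "G \<in> sets (FF (past i))" and al: "0 \<le> alpha i"
    and sym: "transpose B = B" and B: "\<And>n. 0 \<le> B $ n $ n" "\<And>n. B $ n $ n \<le> b"
    and drift: "\<And>z. 0 \<le> z \<bullet> (B *v (Lbar *v z))"
    and kappa: "\<And>w z. w \<in> space M \<Longrightarrow> (laplacian (Adj i w) *v z) \<bullet> (B *v (laplacian (Adj i w) *v z))
       \<le> \<kappa> * (z \<bullet> (B *v z))"
  shows "expectation (\<lambda>w. indicator G w * (X (Suc i) w \<bullet> (B *v X (Suc i) w)))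
    \<le> expectation (\<lambda>w. indicator G w * ((1 + (alpha i)\<^sup>2 * \<kappa>) * (X i w \<bullet> (B *v X i w))
        + (alpha i)\<^sup>2 * (b * (Delta\<^sup>2 / 4) * real (card arcs))))"
proof -
  have GM: "G \<in> events" using G FF_sub by blast
  define h where "h w = (\<chi> n. \<Sum>l\<in>UNIV. A i n l w * err i n l w)" for w
  define L where "L w = laplacian (Adj i w) *v X i w" for w
  let ?I = "indicator G :: 'a \<Rightarrow> real"
  define Q where "Q w = X i w \<bullet> (B *v X i w)" for w
  have Qe: "ess_bounded M Q" unfolding Q_def[abs_def] by (intro ebd)
  have e1: "ess_bounded M (\<lambda>w. X i w \<bullet> (B *v L w))" and e2: "ess_bounded M (\<lambda>w. L w \<bullet> (B *v L w))"
    and e3: "ess_bounded M (\<lambda>w. h w \<bullet> (B *v (X i w - alpha i *\<^sub>R L w)))"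
    and e4: "ess_bounded M (\<lambda>w. h w \<bullet> (B *v h w))"
    unfolding L_def h_def inner_mult_vec
    by (simp_all add: matrix_vector_mult_def, (intro ebd)+)
  have int: "integrable M (\<lambda>w. ?I w * f w)" if "ess_bounded M f" for f
    by (intro ess_bounded_integrable ebd GM that)
  have "expectation (\<lambda>w. ?I w * (X (Suc i) w \<bullet> (B *v X (Suc i) w)))
    = expectation (\<lambda>w. ?I w * Q w - 2 * alpha i * (?I w * (X i w \<bullet> (B *v L w)))
        + (alpha i)\<^sup>2 * (?I w * (L w \<bullet> (B *v L w)))
        + 2 * alpha i * (?I w * (h w \<bullet> (B *v (X i w - alpha i *\<^sub>R L w))))
        + (alpha i)\<^sup>2 * (?I w * (h w \<bullet> (B *v h w))))"
  proof (intro Bochner_Integration.integral_cong refl)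
    fix w assume "w \<in> space M"
    then have "X (Suc i) w = X i w - alpha i *\<^sub>R L w + alpha i *\<^sub>R h w"
      by (simp only: X_Suc L_def h_def)
    then show "?I w * (X (Suc i) w \<bullet> (B *v X (Suc i) w))
      = ?I w * Q w - 2 * alpha i * (?I w * (X i w \<bullet> (B *v L w)))
        + (alpha i)\<^sup>2 * (?I w * (L w \<bullet> (B *v L w)))
        + 2 * alpha i * (?I w * (h w \<bullet> (B *v (X i w - alpha i *\<^sub>R L w))))
        + (alpha i)\<^sup>2 * (?I w * (h w \<bullet> (B *v h w)))"
      by (simp only: quadratic_form_step[OF sym] Q_def) (simp add: indicator_def)
  qed
  also have "\<dots> = expectation (\<lambda>w. ?I w * Q w) - 2 * alpha i * expectation (\<lambda>w. ?I w * (X i w \<bullet> (B *v L w)))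
        + (alpha i)\<^sup>2 * expectation (\<lambda>w. ?I w * (L w \<bullet> (B *v L w)))
        + 2 * alpha i * expectation (\<lambda>w. ?I w * (h w \<bullet> (B *v (X i w - alpha i *\<^sub>R L w))))
        + (alpha i)\<^sup>2 * expectation (\<lambda>w. ?I w * (h w \<bullet> (B *v h w)))"
    using int[OF Qe] int[OF e1] int[OF e2] int[OF e3] int[OF e4] by simp
  \<comment> \<open>The two zeros stand for the drift, discarded because of its favourable sign, and
    for the noise cross term, which vanishes.\<close>
  also have "\<dots> \<le> expectation (\<lambda>w. ?I w * Q w) - 0 + (alpha i)\<^sup>2 * (\<kappa> * expectation (\<lambda>w. ?I w * Q w)) + 0
        + (alpha i)\<^sup>2 * (b * (Delta\<^sup>2 / 4) * real (card arcs) * prob G)"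
  proof (intro add_mono diff_mono order_refl mult_left_mono)
    have "0 \<le> expectation (\<lambda>w. ?I w * (X i w \<bullet> (B *v L w)))"
      unfolding L_def drift_expectation[OF G]
      by (intro Bochner_Integration.integral_nonneg_AE AE_I2) (auto simp: drift)
    then show "0 \<le> 2 * alpha i * expectation (\<lambda>w. ?I w * (X i w \<bullet> (B *v L w)))" using al by simp
    have "expectation (\<lambda>w. ?I w * (L w \<bullet> (B *v L w))) \<le> expectation (\<lambda>w. \<kappa> * (?I w * Q w))"
      using int[OF e2] int[OF Qe]
      by (intro integral_mono) (auto simp: indicator_def Q_def L_def kappa)
    then show "expectation (\<lambda>w. ?I w * (L w \<bullet> (B *v L w))) \<le> \<kappa> * expectation (\<lambda>w. ?I w * Q w)" by simp
    show "2 * alpha i * expectation (\<lambda>w. ?I w * (h w \<bullet> (B *v (X i w - alpha i *\<^sub>R L w)))) \<le> 0"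
      unfolding L_def h_def noise_cross_expectation[OF G] by simp
    show "expectation (\<lambda>w. ?I w * (h w \<bullet> (B *v h w))) \<le> b * (Delta\<^sup>2 / 4) * real (card arcs) * prob G"
      unfolding h_def by (rule noise_quadratic_expectation[OF G B])
  qed auto
  also have "\<dots> = (1 + (alpha i)\<^sup>2 * \<kappa>) * expectation (\<lambda>w. ?I w * Q w)
      + (alpha i)\<^sup>2 * (b * (Delta\<^sup>2 / 4) * real (card arcs)) * prob G"
    by (simp add: algebra_simps)
  also have "\<dots> = expectation (\<lambda>w. (1 + (alpha i)\<^sup>2 * \<kappa>) * (?I w * Q w)
      + (alpha i)\<^sup>2 * (b * (Delta\<^sup>2 / 4) * real (card arcs)) * ?I w)"
    using int[OF Qe] ess_bounded_integrable[OF ess_bounded_indicator[OF GM]] GM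
    by (subst Bochner_Integration.integral_add) simp_all
  also have "\<dots> = expectation (\<lambda>w. ?I w * ((1 + (alpha i)\<^sup>2 * \<kappa>) * Q w
      + (alpha i)\<^sup>2 * (b * (Delta\<^sup>2 / 4) * real (card arcs))))"
    by (intro Bochner_Integration.integral_cong refl) (simp add: indicator_def)
  finally show ?thesis by (simp only: Q_def)
qed

end

section \<open>Deviation from consensus and the norm of a Laplacian\<close>

lemma norm_mean_decomposition:
  fixes z :: "real^'n"
  defines "m \<equiv> (\<Sum>n\<in>UNIV. z $ n) / real CARD('n)"
  shows "(z - m *\<^sub>R 1) \<bullet> 1 = 0"
    and "(norm z)\<^sup>2 = real CARD('n) * m\<^sup>2 + (norm (z - m *\<^sub>R 1))\<^sup>2"
proof -
  have one: "y \<bullet> (1::real^'n) = (\<Sum>n\<in>UNIV. y $ n)" for y by (simp add: inner_vec_def)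
  show o: "(z - m *\<^sub>R 1) \<bullet> 1 = 0"
    by (simp add: inner_diff_left one m_def sum_subtractf)
  have "(norm z)\<^sup>2 = (m *\<^sub>R 1 + (z - m *\<^sub>R 1)) \<bullet> (m *\<^sub>R 1 + (z - m *\<^sub>R 1))"
    by (simp add: dot_square_norm)
  also have "\<dots> = m\<^sup>2 * (1 \<bullet> (1::real^'n)) + 2 * m * ((z - m *\<^sub>R 1) \<bullet> 1) + (norm (z - m *\<^sub>R 1))\<^sup>2"
    unfolding dot_square_norm[symmetric] inner_add_left inner_add_right inner_scaleR_left inner_scaleR_right
    by (simp only: inner_commute[of 1 "z - m *\<^sub>R 1"])
       (simp only: power2_eq_square distrib_left distrib_right mult.assoc mult_2 add.assoc)
  also have "(1::real^'n) \<bullet> 1 = real CARD('n)" by (simp add: one)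
  finally show "(norm z)\<^sup>2 = real CARD('n) * m\<^sup>2 + (norm (z - m *\<^sub>R 1))\<^sup>2"
    by (simp add: o)
qed

text \<open>Cauchy-Schwarz over the N summands of a row costs a factor N. With (a - b)^2 at most 2
  a^2 + 2 b^2, summing over the rows gives the constant 4 N^2.\<close>

lemma laplacian_norm_bound:
  fixes y :: "real^'n"
  assumes "\<And>n. \<not> G n n"
  shows "(norm (laplacian G *v y))\<^sup>2 \<le> 4 * (real CARD('n))\<^sup>2 * (norm y)\<^sup>2"
proof -
  let ?N = "real CARD('n)"
  have "((laplacian G *v y) $ n)\<^sup>2 \<le> ?N * (\<Sum>l\<in>UNIV. 2 * (y $ n)\<^sup>2 + 2 * (y $ l)\<^sup>2)" for n
  proof -
    have "((laplacian G *v y) $ n)\<^sup>2 \<le> (\<Sum>l\<in>UNIV. (if G n l then y $ n - y $ l else 0)\<^sup>2) * ?N"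
      unfolding laplacian_mult[OF assms] by (rule sum_squared_le_sum_of_squares)
    also have "\<dots> \<le> (\<Sum>l\<in>UNIV. 2 * (y $ n)\<^sup>2 + 2 * (y $ l)\<^sup>2) * ?N"
    proof (intro mult_right_mono sum_mono)
      fix l
      have "(y $ n - y $ l)\<^sup>2 \<le> 2 * (y $ n)\<^sup>2 + 2 * (y $ l)\<^sup>2"
        using zero_le_power2[of "y $ n + y $ l"] by (simp add: power2_eq_square algebra_simps)
      then show "(if G n l then y $ n - y $ l else 0)\<^sup>2 \<le> 2 * (y $ n)\<^sup>2 + 2 * (y $ l)\<^sup>2" by simp
    qed simp
    finally show ?thesis by (simp add: mult.commute)
  qed
  then have "(\<Sum>n\<in>UNIV. ((laplacian G *v y) $ n)\<^sup>2)
      \<le> (\<Sum>n\<in>UNIV. ?N * (\<Sum>l\<in>UNIV. 2 * (y $ n)\<^sup>2 + 2 * (y $ l)\<^sup>2))"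
    by (intro sum_mono)
  also have "\<dots> = 4 * ?N\<^sup>2 * (\<Sum>n\<in>UNIV. (y $ n)\<^sup>2)"
  proof -
    define S where "S = (\<Sum>n\<in>UNIV. (y $ n)\<^sup>2)"
    have "(\<Sum>l\<in>UNIV. 2 * (y $ n)\<^sup>2 + 2 * (y $ l)\<^sup>2) = 2 * ?N * (y $ n)\<^sup>2 + 2 * S" for n
      by (simp add: sum.distrib S_def sum_distrib_left)
    moreover have "(\<Sum>n\<in>UNIV. ?N * (2 * ?N * (y $ n)\<^sup>2 + 2 * S)) = 2 * ?N * ?N * S + ?N * (?N * (2 * S))"
      by (simp add: distrib_left sum.distrib S_def sum_distrib_left mult_ac)
    ultimately show ?thesis by (simp add: S_def power2_eq_square)
  qed
  finally show ?thesis
    by (simp add: norm_vec_def L2_set_def sum_nonneg)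
qed

section \<open>Maximal inequalities for the two weighted quadratic forms\<close>

context qc_network
begin

definition edges :: "'n set set" where
  "edges = {{n, l} | n l. n \<noteq> l \<and> prob {w \<in> space M. Adj 0 w n l} > 0}"

text \<open>At most two ordered pairs lie over each unordered edge.\<close>

lemma card_arcs_le: "card arcs \<le> 2 * card edges"
proof -
  have "arcs \<subseteq> (\<Union>e\<in>edges. {(n, l). e = {n, l}})"
    by (auto simp: arcs_def edges_def)
  then have "card arcs \<le> card (\<Union>e\<in>edges. {(n, l). e = {n, l}})"
    by (intro card_mono) auto
  also have "\<dots> \<le> (\<Sum>e\<in>edges. card {(n, l). e = {n, l}})"
    by (intro card_UN_le) simp
  also have "\<dots> \<le> (\<Sum>e\<in>edges. 2)"
  proof (rule sum_mono)
    fix e assume "e \<in> edges"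
    then obtain a b where e: "e = {a, b}" by (auto simp: edges_def)
    have "{(n, l). e = {n, l}} \<subseteq> {(a, b), (b, a)}" unfolding e by (auto simp: doubleton_eq_iff)
    then have "card {(n, l). e = {n, l}} \<le> card {(a, b), (b, a)}" by (intro card_mono) auto
    also have "\<dots> \<le> 2" by (rule card_insert_le_m1) simp_all
    finally show "card {(n, l). e = {n, l}} \<le> 2" .
  qed
  finally show ?thesis by simp
qed

lemma Lbar_sym: "transpose Lbar = Lbar"
proof -
  have "expectation (\<lambda>w. laplacian (Adj 0 w) $ n $ l) = expectation (\<lambda>w. laplacian (Adj 0 w) $ l $ n)" for n l
    by (intro Bochner_Integration.integral_cong refl) (auto simp: laplacian_def graph_sym)
  then show ?thesis by (simp add: vec_eq_iff transpose_def Lbar_def)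
qed

lemma laplacian_sym: "w \<in> space M \<Longrightarrow> transpose (laplacian (Adj i w)) = laplacian (Adj i w)"
  by (auto simp: vec_eq_iff transpose_def laplacian_def graph_sym)

lemma laplacian_one: "w \<in> space M \<Longrightarrow> laplacian (Adj i w) *v 1 = 0"
  using graph_irrefl by (simp add: vec_eq_iff laplacian_mult cong: if_cong)

lemma Lbar_one: "Lbar *v 1 = 0"
proof -
  have "(Lbar *v 1) $ n = expectation (\<lambda>w. \<Sum>l\<in>UNIV. laplacian (Adj 0 w) $ n $ l)" for n
    using ess_bounded_integrable[OF graph_fun_ebd[of "\<lambda>g. laplacian g $ n $ l" 0 for l]]
    by (simp add: matrix_vector_mult_def Lbar_def Bochner_Integration.integral_sum)
  also have "\<dots> n = expectation (\<lambda>w. 0)" for n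
    using laplacian_one[of _ 0]
    by (intro Bochner_Integration.integral_cong refl) (simp add: vec_eq_iff matrix_vector_mult_def)
  finally show ?thesis by (simp add: vec_eq_iff)
qed

text \<open>The weight \<open>p\<close> compensates the multiplicative growth of the form, and
  \<open>r\<close> pays for the additive noise. Keeping them separate serves both a constant
  \<open>p\<close> with shrinking \<open>r\<close> and the choice of equal weights.\<close>

lemma quadratic_maximal:
  fixes B :: "real^'n^'n" and b \<kappa> c :: real
  assumes al: "\<And>i. 0 \<le> alpha i"
    and sym: "transpose B = B" and psd: "\<And>z. 0 \<le> z \<bullet> (B *v z)" and b: "\<And>n. B $ n $ n \<le> b"
    and drift: "\<And>z. 0 \<le> z \<bullet> (B *v (Lbar *v z))"
    and kappa: "\<And>i w z. w \<in> space M \<Longrightarrow> (laplacian (Adj i w) *v z) \<bullet> (B *v (laplacian (Adj i w) *v z))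
       \<le> \<kappa> * (z \<bullet> (B *v z))"
    and p: "\<And>j. 0 \<le> p j" "\<And>j. p (Suc j) * (1 + (alpha j)\<^sup>2 * \<kappa>) \<le> p j"
    and r: "\<And>j. 0 \<le> r j" "\<And>j. p (Suc j) * ((alpha j)\<^sup>2 * (b * (Delta\<^sup>2 / 4) * real (card arcs))) + r (Suc j) \<le> r j"
    and c: "c > 0"
  shows "{w \<in> space M. \<exists>j. c \<le> p j * (X j w \<bullet> (B *v X j w)) + r j} \<in> events
    \<and> prob {w \<in> space M. \<exists>j. c \<le> p j * (X j w \<bullet> (B *v X j w)) + r j} \<le> (p 0 * (x0 \<bullet> (B *v x0)) + r 0) / c"
proof -
  define Q where "Q j w = X j w \<bullet> (B *v X j w)" for j w
  define V where "V j w = p j * Q j w + r j" for j w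
  let ?\<beta> = "b * (Delta\<^sup>2 / 4) * real (card arcs)"
  \<comment> \<open>A diagonal entry is the value of the form at a coordinate vector.\<close>
  have diag: "0 \<le> B $ n $ n" for n
    using psd[of "axis n 1"] by (simp add: matrix_vector_mult_basis inner_axis' column_def)
  have Qe: "ess_bounded M (Q j)" for j unfolding Q_def[abs_def] by (intro ebd)
  have Ve: "ess_bounded M (V j)" for j unfolding V_def[abs_def] by (intro ebd Qe)
  have step: "expectation (\<lambda>w. indicator G w * V (Suc j) w) \<le> expectation (\<lambda>w. indicator G w * V j w)"
    if G: "G \<in> sets (FF (past j))" for G j
  proof -
    have GM: "G \<in> events" using G FF_sub by blast
    let ?I = "indicator G :: 'a \<Rightarrow> real"
    have int: "integrable M (\<lambda>w. ?I w * f w)" if "ess_bounded M f" for f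
      by (intro ess_bounded_integrable ebd GM that)
    have I: "integrable M ?I" by (intro ess_bounded_integrable ebd GM)
    define W where "W w = (1 + (alpha j)\<^sup>2 * \<kappa>) * Q j w + (alpha j)\<^sup>2 * ?\<beta>" for w
    have We: "ess_bounded M W" unfolding W_def[abs_def] by (intro ebd Qe)
    have "expectation (\<lambda>w. ?I w * V (Suc j) w) = expectation (\<lambda>w. p (Suc j) * (?I w * Q (Suc j) w) + r (Suc j) * ?I w)"
      by (intro Bochner_Integration.integral_cong refl) (simp add: V_def indicator_def)
    also have "\<dots> = p (Suc j) * expectation (\<lambda>w. ?I w * Q (Suc j) w) + r (Suc j) * expectation ?I"
      using int[OF Qe, of "Suc j"] I by simp
    also have "\<dots> \<le> p (Suc j) * expectation (\<lambda>w. ?I w * W w) + r (Suc j) * expectation ?I"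
      unfolding Q_def W_def
      by (intro add_right_mono mult_left_mono p quadratic_one_step[OF G al sym diag b drift kappa])
    also have "\<dots> = expectation (\<lambda>w. p (Suc j) * (?I w * W w) + r (Suc j) * ?I w)"
      using int[OF We] I by simp
    also have "\<dots> \<le> expectation (\<lambda>w. ?I w * V j w)"
    proof (rule integral_mono)
      show "integrable M (\<lambda>w. p (Suc j) * (?I w * W w) + r (Suc j) * ?I w)" using int[OF We] I by simp
      show "integrable M (\<lambda>w. ?I w * V j w)" by (rule int[OF Ve])
      fix w
      have "p (Suc j) * W w + r (Suc j) = p (Suc j) * (1 + (alpha j)\<^sup>2 * \<kappa>) * Q j w
          + (p (Suc j) * ((alpha j)\<^sup>2 * ?\<beta>) + r (Suc j))"
        by (simp add: W_def algebra_simps)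
      also have "\<dots> \<le> V j w"
        unfolding V_def by (intro add_mono mult_right_mono p r) (simp add: Q_def psd)
      finally show "p (Suc j) * (?I w * W w) + r (Suc j) * ?I w \<le> ?I w * V j w"
        by (simp add: indicator_def)
    qed
    finally show ?thesis .
  qed
  have Vm: "V j \<in> borel_measurable (FF (past j))" for j
    using quadratic_FF[of j B] unfolding V_def[abs_def] Q_def by measurable
  have sub: "subalgebra M (FF (past j))" for j by (simp add: subalgebra_def FF_sub)
  have nn: "0 \<le> V j w" for j w unfolding V_def Q_def by (simp add: p r psd)
  note mx = supermartingale_maximal_inequality[where V = V and F = "\<lambda>j. FF (past j)",
      OF sub FF_mono[OF past_Suc(1)] Vm ess_bounded_integrable[OF Ve] nn step c]
  have V0: "expectation (V 0) = p 0 * (x0 \<bullet> (B *v x0)) + r 0"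
    by (simp add: V_def[abs_def] Q_def prob_space)
  show ?thesis using mx unfolding V0 by (simp only: V_def Q_def simp_thms)
qed

text \<open>The average is moved only by noise: a Laplacian image is orthogonal to 1, so \<kappa> is
  0 and \<open>p\<close> is constantly 1. The bound is attached to an event \<open>E\<close>
  containing the set of interest, where the process with its reserve \<open>r\<close> reaches
  \<open>c\<close>.\<close>

lemma average_maximal:
  assumes al: "\<And>i. 0 \<le> alpha i" and sm: "summable (\<lambda>i. (alpha i)\<^sup>2)" and c: "c > 0"
  shows "\<exists>E\<in>events. {w \<in> space M. \<exists>j. c \<le> ((\<Sum>n\<in>UNIV. X j w $ n) / real CARD('n))\<^sup>2} \<subseteq> E
    \<and> prob E \<le> (((\<Sum>n\<in>UNIV. x0 $ n) / real CARD('n))\<^sup>2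
        + Delta\<^sup>2 / 4 * real (card arcs) / (real CARD('n))\<^sup>2 * (\<Sum>j. (alpha j)\<^sup>2)) / c"
proof -
  let ?N = "real CARD('n)"
  define B :: "real^'n^'n" where "B = (\<chi> n m. 1 / ?N\<^sup>2)"
  define K where "K = 1 / ?N\<^sup>2 * (Delta\<^sup>2 / 4) * real (card arcs)"
  \<comment> \<open>The noise budget still unspent at time \<open>j\<close>: the tail of the
    step-size series times the variance constant \<open>K\<close>. Its decrease is exactly what step
    \<open>j\<close> may add.\<close>
  define r where "r j = K * ((\<Sum>j. (alpha j)\<^sup>2) - (\<Sum>k<j. (alpha k)\<^sup>2))" for j
  have K: "K \<ge> 0" by (simp add: K_def)
  have By: "x \<bullet> (B *v y) = (x \<bullet> 1) * (y \<bullet> 1) / ?N\<^sup>2" for x y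
    by (simp add: inner_mult_vec B_def) (simp add: inner_vec_def sum_product sum_divide_distrib)
  have BQ: "x \<bullet> (B *v x) = ((\<Sum>n\<in>UNIV. x $ n) / ?N)\<^sup>2" for x
    unfolding By by (simp add: inner_vec_def power2_eq_square)
  have ker: "(S *v z) \<bullet> 1 = 0" if "transpose S = S" "S *v 1 = 0" for S :: "real^'n^'n" and z
    by (simp add: sym_mat_inner that)
  define E where "E = {w \<in> space M. \<exists>j. c \<le> 1 * (X j w \<bullet> (B *v X j w)) + r j}"
  have r0: "0 \<le> r j" for j
    unfolding r_def using sum_le_suminf[OF sm, of "{..<j}"] K by simp
  have "E \<in> events \<and>
    prob E \<le> (1 * (x0 \<bullet> (B *v x0)) + r 0) / c"
    unfolding E_def
  proof (rule quadratic_maximal[where b = "1 / ?N\<^sup>2" and \<kappa> = 0 and p = "\<lambda>_. 1" and r = r, OF al])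
    show "transpose B = B" by (simp add: B_def transpose_def)
    show "1 * ((alpha j)\<^sup>2 * (1 / ?N\<^sup>2 * (Delta\<^sup>2 / 4) * real (card arcs))) + r (Suc j) \<le> r j" for j
      unfolding K_def[symmetric] by (simp add: r_def algebra_simps)
    show "0 \<le> z \<bullet> (B *v z)" for z by (simp add: BQ)
    show "0 \<le> z \<bullet> (B *v (Lbar *v z))" for z by (simp only: By ker[OF Lbar_sym Lbar_one] mult_zero_right div_0 order_refl)
    show "(laplacian (Adj i w) *v z) \<bullet> (B *v (laplacian (Adj i w) *v z)) \<le> 0 * (z \<bullet> (B *v z))"
      if "w \<in> space M" for i w z
      by (simp only: By ker[OF laplacian_sym[OF that] laplacian_one[OF that]] mult_zero_left div_0 order_refl)
    show "B $ n $ n \<le> 1 / ?N\<^sup>2" for n by (simp add: B_def)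
    show "0 \<le> r j" for j by (rule r0)
    show "0 < c" by (rule c)
  qed simp_all
  moreover have "{w \<in> space M. \<exists>j. c \<le> ((\<Sum>n\<in>UNIV. X j w $ n) / ?N)\<^sup>2}
      \<subseteq> E"
  proof safe
    fix w j assume w: "w \<in> space M" and "c \<le> ((\<Sum>n\<in>UNIV. X j w $ n) / ?N)\<^sup>2"
    then have "c \<le> 1 * (X j w \<bullet> (B *v X j w)) + r j"
      using r0[of j] by (simp add: BQ)
    then show "w \<in> E" using w unfolding E_def by blast
  qed
  moreover have "1 * (x0 \<bullet> (B *v x0)) + r 0 = ((\<Sum>n\<in>UNIV. x0 $ n) / ?N)\<^sup>2
        + Delta\<^sup>2 / 4 * real (card arcs) / ?N\<^sup>2 * (\<Sum>j. (alpha j)\<^sup>2)"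
    by (simp add: BQ r_def K_def)
  ultimately show ?thesis by (intro bexI[of _ E] conjI) simp_all
qed

text \<open>With V = 1 + x^T Lbar x, one step gives at most V plus \<open>(alpha j)^2\<close> times
  a multiple of the form plus a multiple of 1. As \<gamma> dominates both multiples, the mean of V
  grows by at most the factor \<open>1 + (alpha j)^2 * \<gamma>\<close>. The second claim turns
  distance to consensus into the form.\<close>

lemma lyapunov_maximal:
  assumes N2: "CARD('n) \<ge> 2" and pos: "eigval Lbar 2 > 0"
    and al: "\<And>i. 0 \<le> alpha i" and c: "c > 0" and gam: "0 \<le> \<gamma>"
    and sm: "summable (\<lambda>i. (alpha i)\<^sup>2)"
    and g1: "4 * (real CARD('n))\<^sup>2 * eigval Lbar CARD('n) / eigval Lbar 2 \<le> \<gamma>"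
    and g2: "eigval Lbar CARD('n) * (Delta\<^sup>2 / 4) * real (card arcs) \<le> \<gamma>"
  shows "\<exists>E\<in>events. {w \<in> space M. \<exists>j. c \<le> 1 + X j w \<bullet> (Lbar *v X j w)} \<subseteq> E
    \<and> prob E \<le> (1 + x0 \<bullet> (Lbar *v x0)) * (\<Prod>j. 1 + (alpha j)\<^sup>2 * \<gamma>) / c"
    and "eigval Lbar 2 * (norm (z - ((\<Sum>n\<in>UNIV. z $ n) / real CARD('n)) *\<^sub>R 1))\<^sup>2 \<le> z \<bullet> (Lbar *v z)"
proof -
  let ?N = "real CARD('n)"
  let ?lN = "eigval Lbar CARD('n)" and ?l2 = "eigval Lbar 2"
  note eb = symmetric_eigval_bounds[OF Lbar_sym N2 Lbar_one pos]
  define perp where "perp z = z - ((\<Sum>n\<in>UNIV. z $ n) / ?N) *\<^sub>R 1" for z :: "real^'n"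
  have Mperp: "S *v perp z = S *v z" if "S *v 1 = 0" for S :: "real^'n^'n" and z
    by (simp add: perp_def matrix_vector_mult_diff_distrib matrix_vector_mult_scaleR that)
  have low: "?l2 * (norm (perp z))\<^sup>2 \<le> z \<bullet> (Lbar *v z)" for z
  proof -
    have "?l2 * (norm (perp z))\<^sup>2 \<le> perp z \<bullet> (Lbar *v perp z)"
      unfolding dot_square_norm[symmetric] using eb(3)[of "perp z"] norm_mean_decomposition(1)[of z]
      by (simp add: perp_def)
    also have "\<dots> = (Lbar *v perp z) \<bullet> z"
      by (simp add: Mperp[OF Lbar_one]) (metis Mperp[OF Lbar_one] sym_mat_inner[OF Lbar_sym] inner_commute)
    finally show ?thesis by (simp add: Mperp[OF Lbar_one] inner_commute)
  qed
  then show "?l2 * (norm (z - ((\<Sum>n\<in>UNIV. z $ n) / ?N) *\<^sub>R 1))\<^sup>2 \<le> z \<bullet> (Lbar *v z)"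
    by (simp add: perp_def)
  have psd: "0 \<le> z \<bullet> (Lbar *v z)" for z
    using low[of z] pos by (meson less_imp_le mult_nonneg_nonneg order_trans zero_le_power2)
  define f where "f j = 1 + (alpha j)\<^sup>2 * \<gamma>" for j
  define q where "q j = (\<Prod>k<j. f k)" for j
  have f1: "1 \<le> f j" for j using gam by (simp add: f_def)
  have q1: "1 \<le> q j" for j unfolding q_def by (intro prod_ge_1 f1)
  have "convergent_prod f"
    unfolding f_def using sm gam
    by (intro summable_imp_convergent_prod_real) (auto simp: abs_mult intro: summable_mult2, smt (verit) mult_nonneg_nonneg zero_le_power2)
  then have fp: "f has_prod (prodinf f)" by (rule convergent_prod_has_prod)
  have qP: "q j \<le> prodinf f" for j
    unfolding q_def by (rule prod_le_prodinf[OF fp]) (use f1 order_trans[OF zero_le_one] in auto)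
  have P1: "1 \<le> prodinf f" using qP[of 0] by (simp add: q_def)
  \<comment> \<open>Since every partial product is below the infinite one, V reaching
    \<open>c\<close> forces V divided by \<open>q j\<close> to reach \<open>c'\<close>. This places
    the infinite product in the bound.\<close>
  define c' where "c' = c / prodinf f"
  have c': "c' > 0" using c P1 by (simp add: c'_def)
  define E where "E = {w \<in> space M. \<exists>j. c' \<le> 1 / q j * (X j w \<bullet> (Lbar *v X j w)) + 1 / q j}"
  have qS: "q (Suc j) = q j * f j" for j by (simp add: q_def)
  have key: "1 / q (Suc j) * (1 + (alpha j)\<^sup>2 * t) \<le> 1 / q j" if "t \<le> \<gamma>" for t j
  proof -
    have "1 + (alpha j)\<^sup>2 * t \<le> f j" using that by (simp add: f_def mult_left_mono)
    then have "1 / q (Suc j) * (1 + (alpha j)\<^sup>2 * t) \<le> 1 / q (Suc j) * f j"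
      using q1[of "Suc j"] by (intro mult_left_mono) auto
    also have "\<dots> = 1 / q j" using f1[of j] by (simp add: qS)
    finally show ?thesis .
  qed
  have "E \<in> events \<and> prob E \<le> (1 / q 0 * (x0 \<bullet> (Lbar *v x0)) + 1 / q 0) / c'"
    unfolding E_def
  proof (rule quadratic_maximal[where b = ?lN and \<kappa> = "4 * ?N\<^sup>2 * ?lN / ?l2", OF al Lbar_sym psd])
    \<comment> \<open>A diagonal entry is a Rayleigh quotient at a coordinate vector, hence at most
      the largest eigenvalue.\<close>
    show "Lbar $ n $ n \<le> ?lN" for n
      using eb(2)[of "axis n 1"] by (simp add: matrix_vector_mult_basis inner_axis' column_def)
    \<comment> \<open>By symmetry this is the squared norm of \<open>Lbar *v z\<close>.\<close>
    show "0 \<le> z \<bullet> (Lbar *v (Lbar *v z))" for z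
      by (metis sym_mat_inner[OF Lbar_sym] inner_ge_zero)
    show "0 \<le> 1 / q j" "0 \<le> 1 / q j" for j using q1[of j] by simp_all
    show "1 / q (Suc j) * (1 + (alpha j)\<^sup>2 * (4 * ?N\<^sup>2 * ?lN / ?l2)) \<le> 1 / q j" for j
      by (rule key[OF g1])
    show "0 < c'" by (rule c')
    show "1 / q (Suc j) * ((alpha j)\<^sup>2 * (?lN * (Delta\<^sup>2 / 4) * real (card arcs))) + 1 / q (Suc j) \<le> 1 / q j" for j
      using key[OF g2, of j] by (simp add: algebra_simps)
    show "(laplacian (Adj i w) *v z) \<bullet> (Lbar *v (laplacian (Adj i w) *v z)) \<le> 4 * ?N\<^sup>2 * ?lN / ?l2 * (z \<bullet> (Lbar *v z))"
      if w: "w \<in> space M" for i w z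
    proof -
      let ?L = "laplacian (Adj i w)"
      \<comment> \<open>A Laplacian sees only the deviation from consensus. The three factors
        collected are the largest eigenvalue of \<open>Lbar\<close>, then 4 N^2 from the norm bound,
        then 1/\<open>?l2\<close> from passing back to the form.\<close>
      have "(?L *v z) \<bullet> (Lbar *v (?L *v z)) \<le> ?lN * (norm (?L *v perp z))\<^sup>2"
        using eb(2)[of "?L *v z"] by (simp add: Mperp[OF laplacian_one[OF w]] dot_square_norm)
      also have "\<dots> \<le> ?lN * (4 * ?N\<^sup>2 * (norm (perp z))\<^sup>2)"
        using eb(1) graph_irrefl[OF w] by (intro mult_left_mono laplacian_norm_bound) auto
      also have "\<dots> \<le> ?lN * (4 * ?N\<^sup>2 * (z \<bullet> (Lbar *v z) / ?l2))"
        using eb(1) low[of z] pos by (intro mult_left_mono) (auto simp: field_simps)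
      finally show ?thesis by (simp add: mult_ac)
    qed
  qed
  moreover have "(1 / q 0 * (x0 \<bullet> (Lbar *v x0)) + 1 / q 0) / c' = (1 + x0 \<bullet> (Lbar *v x0)) * prodinf f / c"
    by (simp add: q_def c'_def add.commute)
  moreover have "{w \<in> space M. \<exists>j. c \<le> 1 + X j w \<bullet> (Lbar *v X j w)} \<subseteq> E"
  proof safe
    fix w j assume w: "w \<in> space M" and j: "c \<le> 1 + X j w \<bullet> (Lbar *v X j w)"
    have "c' \<le> c / q j" unfolding c'_def using c q1[of j] qP[of j] by (intro divide_left_mono) auto
    also have "\<dots> \<le> (1 + X j w \<bullet> (Lbar *v X j w)) / q j"
      using j q1[of j] by (intro divide_right_mono) auto
    finally have "c' \<le> 1 / q j * (X j w \<bullet> (Lbar *v X j w)) + 1 / q j" by (simp add: add_divide_distrib)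
    then show "w \<in> E" using w by (auto simp: E_def)
  qed
  ultimately show "\<exists>E\<in>events. {w \<in> space M. \<exists>j. c \<le> 1 + X j w \<bullet> (Lbar *v X j w)} \<subseteq> E
    \<and> prob E \<le> (1 + x0 \<bullet> (Lbar *v x0)) * (\<Prod>j. 1 + (alpha j)\<^sup>2 * \<gamma>) / c"
    unfolding f_def[symmetric] by (intro bexI[of _ E] conjI) simp_all
qed

lemma sup_norm_bound:
  fixes a :: real
  assumes N2: "CARD('n) \<ge> 2" and pos: "eigval Lbar 2 > 0" and al: "\<And>i. alpha i > 0"
    and sm: "summable (\<lambda>i. (alpha i)\<^sup>2)" and a: "a > 0"
  defines "N \<equiv> CARD('n)"
  shows "prob {w \<in> space M. (SUP j. ereal (norm (X j w))) > ereal a}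
     \<le> sqrt (2 * real N * ((\<Sum>n\<in>UNIV. x0 $ n) / real N)\<^sup>2
          + 4 * real (card edges) * Delta\<^sup>2 / (3 * real N) * (\<Sum>j. (alpha j)\<^sup>2)) / a
       + (1 + x0 \<bullet> (Lbar *v x0))
         * (\<Prod>j. 1 + (alpha j)\<^sup>2 *
              max ((eigval Lbar N) ^ 3 / eigval Lbar 2 + 4 * (real N)\<^sup>2 * eigval Lbar N / eigval Lbar 2)
                  (2 * real (card edges) * Delta\<^sup>2 * eigval Lbar N / 3))
         / (1 + a\<^sup>2 / 2 * eigval Lbar 2)"
proof -
  let ?S = "\<Sum>j. (alpha j)\<^sup>2" and ?lN = "eigval Lbar N" and ?l2 = "eigval Lbar 2"
  let ?m = "\<lambda>z :: real^'n. (\<Sum>n\<in>UNIV. z $ n) / real N"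
  define \<gamma> where "\<gamma> = max (?lN ^ 3 / ?l2 + 4 * (real N)\<^sup>2 * ?lN / ?l2) (2 * real (card edges) * Delta\<^sup>2 * ?lN / 3)"
  have al0: "0 \<le> alpha i" for i using al[of i] by simp
  have N: "real N > 0" using N2 by (simp add: N_def)
  have lN: "?lN > 0" unfolding N_def by (rule symmetric_eigval_bounds(1)[OF Lbar_sym N2 Lbar_one pos])
  have S: "0 \<le> ?S" by (intro suminf_nonneg sm) simp
  have arcs: "real (card arcs) \<le> 2 * real (card edges)"
    using card_arcs_le by linarith
  have "0 \<le> ?lN ^ 3 / ?l2" using lN pos by simp
  then have g1: "4 * (real CARD('n))\<^sup>2 * eigval Lbar CARD('n) / ?l2 \<le> \<gamma>"
    unfolding \<gamma>_def N_def[symmetric] by linarith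
  have g2: "eigval Lbar CARD('n) * (Delta\<^sup>2 / 4) * real (card arcs) \<le> \<gamma>"
  proof -
    \<comment> \<open>Two arcs per edge with variance at most \<open>Delta^2 / 4\<close> each make
      \<open>Delta^2 / 2\<close> per edge, which is below the \<open>2 * Delta^2 / 3\<close> in
      \<gamma>.\<close>
    have "?lN * (Delta\<^sup>2 / 4) * real (card arcs) \<le> ?lN * (Delta\<^sup>2 / 4) * (2 * real (card edges))"
      using lN arcs by (intro mult_left_mono) auto
    also have "\<dots> \<le> 2 * real (card edges) * Delta\<^sup>2 * ?lN / 3"
    proof -
      have "0 \<le> real (card edges) * Delta\<^sup>2 * ?lN" using lN by simp
      then show ?thesis by (simp add: algebra_simps)
    qed
    finally show ?thesis unfolding \<gamma>_def N_def[symmetric] by linarith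
  qed
  have gam: "0 \<le> \<gamma>" using lN by (simp add: \<gamma>_def le_max_iff_disj)
  \<comment> \<open>Thresholds from the equal split of \<open>a^2\<close>: the average part of the
    squared norm is N times the squared average, and the other part is weighted by the second
    eigenvalue.\<close>
  define c1 where "c1 = a\<^sup>2 / (2 * real N)"
  define c2 where "c2 = 1 + a\<^sup>2 / 2 * ?l2"
  have c1: "c1 > 0" using a N by (simp add: c1_def)
  have c2: "c2 > 0" using a pos by (simp add: c2_def add_pos_pos)
  from average_maximal[OF al0 sm c1] obtain E1 where E1: "E1 \<in> events"
    "{w \<in> space M. \<exists>j. c1 \<le> (?m (X j w))\<^sup>2} \<subseteq> E1"
    "prob E1 \<le> ((?m x0)\<^sup>2 + Delta\<^sup>2 / 4 * real (card arcs) / (real N)\<^sup>2 * ?S) / c1"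
    unfolding N_def by blast
  note ly = lyapunov_maximal[OF N2 pos al0 c2 gam sm g1 g2]
  from ly(1) obtain E2 where E2: "E2 \<in> events"
    "{w \<in> space M. \<exists>j. c2 \<le> 1 + X j w \<bullet> (Lbar *v X j w)} \<subseteq> E2"
    "prob E2 \<le> (1 + x0 \<bullet> (Lbar *v x0)) * (\<Prod>j. 1 + (alpha j)\<^sup>2 * \<gamma>) / c2" by blast
  define Z where "Z = 2 * real N * (?m x0)\<^sup>2 + 4 * real (card edges) * Delta\<^sup>2 / (3 * real N) * ?S"
  have Z0: "0 \<le> Z" using S by (simp add: Z_def)
  have "prob E1 \<le> Z / a\<^sup>2"
  proof -
    have "Delta\<^sup>2 / 4 * real (card arcs) / (real N)\<^sup>2 * ?S \<le> Delta\<^sup>2 / 4 * (2 * real (card edges)) / (real N)\<^sup>2 * ?S"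
      using arcs S by (intro mult_right_mono divide_right_mono mult_left_mono) auto
    also have "\<dots> \<le> 2 * (real (card edges) * Delta\<^sup>2 / (3 * (real N)\<^sup>2) * ?S)"
    proof -
      have "0 \<le> real (card edges) * Delta\<^sup>2 / (real N)\<^sup>2 * ?S" using S by simp
      then show ?thesis by (simp add: algebra_simps)
    qed
    finally have "prob E1 \<le> ((?m x0)\<^sup>2 + 2 * (real (card edges) * Delta\<^sup>2 / (3 * (real N)\<^sup>2) * ?S)) / c1"
      using E1(3) c1 by (meson add_left_mono divide_right_mono less_imp_le order_trans)
    also have "\<dots> = Z / a\<^sup>2"
      using N a by (simp add: Z_def c1_def power2_eq_square field_simps)
    finally show ?thesis .
  qed
  have p1: "prob E1 \<le> sqrt Z / a"
  proof (cases "Z / a\<^sup>2 \<le> 1")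
    case True
    have "Z / a\<^sup>2 \<le> sqrt (Z / a\<^sup>2)"
    proof (rule real_le_rsqrt)
      have "0 \<le> Z / a\<^sup>2" using Z0 by simp
      from mult_left_le[OF True this] show "(Z / a\<^sup>2)\<^sup>2 \<le> Z / a\<^sup>2" by (simp only: power2_eq_square)
    qed
    also have "\<dots> = sqrt Z / a" using a by (simp add: real_sqrt_divide)
    finally show ?thesis using \<open>prob E1 \<le> Z / a\<^sup>2\<close> by linarith
  next
    case False
    then have "1 \<le> sqrt (Z / a\<^sup>2)" by simp
    also have "\<dots> = sqrt Z / a" using a by (simp add: real_sqrt_divide)
    finally show ?thesis using prob_le_1[of E1] by linarith
  qed
  have "{w \<in> space M. (SUP j. ereal (norm (X j w))) > ereal a} \<subseteq> E1 \<union> E2"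
  proof
    fix w assume "w \<in> {w \<in> space M. (SUP j. ereal (norm (X j w))) > ereal a}"
    \<comment> \<open>The supremum lies in the extended reals, so unbounded paths are covered, and
      exceeding \<open>a\<close> means that a single time already exceeds it.\<close>
    then obtain j where w: "w \<in> space M" and j: "a < norm (X j w)" by (auto simp: less_SUP_iff)
    let ?p = "(norm (X j w - ?m (X j w) *\<^sub>R 1))\<^sup>2"
    have "a\<^sup>2 < (norm (X j w))\<^sup>2" using j a by (intro power_strict_mono) auto
    also have "\<dots> = real N * (?m (X j w))\<^sup>2 + ?p"
      unfolding N_def by (rule norm_mean_decomposition(2))
    finally have "a\<^sup>2 / 2 \<le> real N * (?m (X j w))\<^sup>2 \<or> a\<^sup>2 / 2 \<le> ?p" by linarith
    then show "w \<in> E1 \<union> E2"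
    proof
      assume "a\<^sup>2 / 2 \<le> real N * (?m (X j w))\<^sup>2"
      then have "c1 \<le> (?m (X j w))\<^sup>2" using N by (simp add: c1_def field_simps)
      then show ?thesis using w E1(2) by blast
    next
      assume "a\<^sup>2 / 2 \<le> ?p"
      then have "a\<^sup>2 / 2 * ?l2 \<le> ?l2 * ?p" using pos by (simp add: mult.commute mult_left_mono)
      also have "\<dots> \<le> X j w \<bullet> (Lbar *v X j w)" unfolding N_def by (rule ly(2))
      finally have "c2 \<le> 1 + X j w \<bullet> (Lbar *v X j w)" by (simp add: c2_def)
      then show ?thesis using w E2(2) by blast
    qed
  qed
  \<comment> \<open>Monotonicity asks only the larger set to be an event.\<close>
  then have "prob {w \<in> space M. (SUP j. ereal (norm (X j w))) > ereal a} \<le> prob (E1 \<union> E2)"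
    using E1(1) E2(1) by (intro finite_measure_mono) auto
  also have "\<dots> \<le> prob E1 + prob E2" using E1(1) E2(1) by (rule measure_Un_le)
  also have "\<dots> \<le> sqrt Z / a + (1 + x0 \<bullet> (Lbar *v x0)) * (\<Prod>j. 1 + (alpha j)\<^sup>2 * \<gamma>) / c2"
    using p1 E2(3) by (rule add_mono)
  finally show ?thesis unfolding Z_def \<gamma>_def c2_def .
qed

end

subsection \<open>Boundedness of the states\<close>

theorem mainTheorem10:
  fixes M :: "'a measure"
    and Adj :: "nat \<Rightarrow> 'a \<Rightarrow> 'n::finite \<Rightarrow> 'n \<Rightarrow> bool"
    and nu :: "nat \<Rightarrow> 'n \<Rightarrow> 'n \<Rightarrow> 'a \<Rightarrow> real"
    and alpha :: "nat \<Rightarrow> real"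
    and Delta a :: real
    and x0 :: "real^'n"
  defines "Lbar \<equiv> (\<chi> n l. prob_space.expectation M (\<lambda>w. laplacian (Adj 0 w) $ n $ l))"
    and "Medges \<equiv> {{n, l} | n l. n \<noteq> l \<and> measure M {w \<in> space M. Adj 0 w n l} > 0}"
    and "N \<equiv> CARD('n)"
  assumes P: "prob_space M"
    and N2: "CARD('n) \<ge> 2"
    and graph_sym: "\<And>i w n l. w \<in> space M \<Longrightarrow> Adj i w n l = Adj i w l n"
    and graph_irrefl: "\<And>i w n. w \<in> space M \<Longrightarrow> \<not> Adj i w n n"
    and graph_meas: "\<And>i. Adj i \<in> measurable M (count_space UNIV)"
    and graph_ident: "\<And>i. distr M (count_space UNIV) (Adj i) = distr M (count_space UNIV) (Adj 0)"
    and nu_meas: "\<And>i n l. nu i n l \<in> borel_measurable M"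
    and nu_unif: "\<And>i n l. distr M lborel (nu i n l) = uniform_measure lborel {- Delta / 2 ..< Delta / 2}"
    and indep: "prob_space.indep_sets M
          (\<lambda>k. case k of
                 Inl i \<Rightarrow> {Adj i -` A \<inter> space M | A. A \<in> sets (count_space UNIV)}
               | Inr (i, n, l) \<Rightarrow> {nu i n l -` B \<inter> space M | B. B \<in> sets borel})
          UNIV"
    and lambda2_pos: "eigval Lbar 2 > 0"
    and Delta_pos: "Delta > 0"
    and alpha_pos: "\<And>i. alpha i > 0"
    and alpha_not_summable: "\<not> summable alpha"
    and alpha_sq_summable: "summable (\<lambda>i. (alpha i)\<^sup>2)"
    and a_pos: "a > 0"
  shows "measure M {w \<in> space M.
            (SUP j. ereal (norm (qc_state Delta alpha Adj nu x0 j w))) > ereal a}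
         \<le> sqrt (2 * real N * ((\<Sum>n\<in>UNIV. x0 $ n) / real N)\<^sup>2
                  + 4 * real (card Medges) * Delta\<^sup>2 / (3 * real N) * (\<Sum>j. (alpha j)\<^sup>2)) / a
           + (1 + x0 \<bullet> (Lbar *v x0))
             * (\<Prod>j. 1 + (alpha j)\<^sup>2 *
                  max ((eigval Lbar N) ^ 3 / eigval Lbar 2 + 4 * (real N)\<^sup>2 * eigval Lbar N / eigval Lbar 2)
                      (2 * real (card Medges) * Delta\<^sup>2 * eigval Lbar N / 3))
             / (1 + a\<^sup>2 / 2 * eigval Lbar 2)"
proof -
  interpret Q: qc_network M Adj nu alpha Delta x0
    by (intro qc_network.intro qc_network_axioms.intro P graph_sym graph_irrefl graph_meas
        graph_ident nu_meas nu_unif indep Delta_pos)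
  have L: "Lbar = Q.Lbar" by (simp only: Lbar_def Q.Lbar_def)
  have E: "Medges = Q.edges" by (simp only: Medges_def Q.edges_def)
  show ?thesis
    unfolding L E N_def
    by (rule Q.sup_norm_bound[OF N2 lambda2_pos[unfolded L] alpha_pos alpha_sq_summable a_pos])
qed

end
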